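(* Let $H=A-\sigma V(x)$ be an operator in $L^2(\mathbb{R}^d)$, $d\ge 1$, where the operator $A$ is defined by $\widehat{A\psi}(k)=a(k)\widehat{\psi}(k)$ and the real-valued continuous function $a$ has the properties $$a(k)>0\ \text{ when } k\neq 0,\qquad a(k)\le C|k|^d,\quad k\to 0 .$$ If $V\in L^1(\mathbb{R}^d)$ and the integral of $V$ is strictly positive, $$\int_{\mathbb{R}^d}V(x)\,dx>0,$$ then the negative spectrum of the operator $H=A-\sigma V$ with an arbitrarily small $\sigma>0$ is not empty.
   Context: $\widehat{\psi}$ denotes the Fourier transform of $\psi$; $C$ is a constant. The potential $V$ is real-valued. The negative spectrum is the part of the spectrum of $H$ lying in $(-\infty,0)$.
   Formalization: As V is only in L¹, A−σV need not define an operator; H is taken to be the operator of the form ∫a|ψ̂|²−σ∫V|ψ|² on ψ in L² with both integrals absolutely convergent, and is assumed self-adjoint with domain dense in the form domain for the natural form norm. *)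

theory Defs
  imports "HOL-Analysis.Analysis"
begin

text \<open>
  Elements of \<open>L\<^sup>2(\<real>\<^sup>d)\<close> are represented by square integrable functions; equality in
  \<open>L\<^sup>2\<close> is equality almost everywhere.
\<close>

definition L2 :: "(real^'n \<Rightarrow> complex) set" where
  "L2 = {f \<in> borel_measurable lborel. integrable lborel (\<lambda>x. (cmod (f x))\<^sup>2)}"

definition L2_inner :: "(real^'n \<Rightarrow> complex) \<Rightarrow> (real^'n \<Rightarrow> complex) \<Rightarrow> complex" where
  "L2_inner f g = (LINT x|lborel. f x * cnj (g x))"

definition L2_norm :: "(real^'n \<Rightarrow> complex) \<Rightarrow> real" where
  "L2_norm f = sqrt (LINT x|lborel. (cmod (f x))\<^sup>2)"

text \<open>
  The unitary Fourier transform on \<open>L\<^sup>2\<close>: the \<open>L\<^sup>2\<close> limit, as \<open>R \<rightarrow> \<infinity>\<close>, of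
  \<open>(2\<pi>)\<^sup>-\<^sup>d\<^sup>/\<^sup>2 \<integral>\<^bsub>|x| \<le> R\<^esub> f(x) exp(-i k\<cdot>x) dx\<close>. By Plancherel's theorem the limit exists for
  every \<open>f\<close> in \<open>L\<^sup>2\<close>, and it is unique almost everywhere. The distance is measured
  with the nonnegative integral, as the Bochner integral of a non-integrable function is 0.
\<close>

definition fourier_trunc :: "(real^'n \<Rightarrow> complex) \<Rightarrow> real \<Rightarrow> real^'n \<Rightarrow> complex" where
  "fourier_trunc f R k = of_real ((2 * pi) powr (- real CARD('n) / 2)) *
     (LINT x:cball 0 R|lborel. f x * exp (- \<i> * of_real (k \<bullet> x)))"

definition is_L2_fourier :: "(real^'n \<Rightarrow> complex) \<Rightarrow> (real^'n \<Rightarrow> complex) \<Rightarrow> bool" where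
  "is_L2_fourier f F \<longleftrightarrow> F \<in> L2 \<and>
     ((\<lambda>R. \<integral>\<^sup>+k. ennreal ((cmod (fourier_trunc f R k - F k))\<^sup>2) \<partial>lborel) \<longlongrightarrow> 0) at_top"

definition L2_fourier :: "(real^'n \<Rightarrow> complex) \<Rightarrow> (real^'n \<Rightarrow> complex)" where
  "L2_fourier f = (SOME F. is_L2_fourier f F)"

text \<open>
  An unbounded operator in \<open>L\<^sup>2\<close> is given by its graph. A graph that equals its adjoint is
  automatically a closed linear subspace and closed under almost everywhere equality, and density
  of the domain makes it single-valued almost everywhere.
\<close>

type_synonym 'n L2_op = "((real^'n \<Rightarrow> complex) \<times> (real^'n \<Rightarrow> complex)) set"

definition densely_defined :: "'n::finite L2_op \<Rightarrow> bool" where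
  "densely_defined T \<longleftrightarrow>
     (\<forall>g\<in>L2. \<forall>\<epsilon>>0. \<exists>f\<in>Domain T. L2_norm (\<lambda>x. f x - g x) < \<epsilon>)"

definition adjoint_op :: "'n::finite L2_op \<Rightarrow> 'n L2_op" where
  "adjoint_op T = {(g, h). g \<in> L2 \<and> h \<in> L2 \<and> (\<forall>(f, f')\<in>T. L2_inner f' g = L2_inner f h)}"

definition self_adjoint :: "'n::finite L2_op \<Rightarrow> bool" where
  "self_adjoint T \<longleftrightarrow> densely_defined T \<and> adjoint_op T = T"

text \<open>
  \<open>z\<close> is in the resolvent set if \<open>T - z\<close> maps the domain of \<open>T\<close> onto \<open>L\<^sup>2\<close> and has a bounded
  inverse; the norm estimate also expresses injectivity.
\<close>

definition resolvent_set :: "'n::finite L2_op \<Rightarrow> complex set" where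
  "resolvent_set T = {z.
     (\<forall>g\<in>L2. \<exists>(f, f')\<in>T. AE x in lborel. f' x - z * f x = g x) \<and>
     (\<exists>M. \<forall>(f, f')\<in>T. L2_norm f \<le> M * L2_norm (\<lambda>x. f' x - z * f x))}"

definition op_spectrum :: "'n::finite L2_op \<Rightarrow> complex set" where
  "op_spectrum T = - resolvent_set T"

definition negative_spectrum :: "'n::finite L2_op \<Rightarrow> real set" where
  "negative_spectrum T = {\<mu>. \<mu> < 0 \<and> complex_of_real \<mu> \<in> op_spectrum T}"

text \<open>
  A potential that is merely in \<open>L\<^sup>1\<close> need not map any nonzero element of the domain of \<open>A\<close> into
  \<open>L\<^sup>2\<close>, so \<open>A - \<sigma>V\<close> is understood in the sense of quadratic forms. Here \<open>A\<close> is the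
  Fourier multiplier with symbol \<open>a \<ge> 0\<close>; its form is \<open>(A\<psi>, \<phi>) = \<integral> a(k) \<psi>^(k) \<phi>^(k)* dk\<close>.
\<close>

definition form_domain :: "(real^'n \<Rightarrow> real) \<Rightarrow> (real^'n \<Rightarrow> real) \<Rightarrow> (real^'n \<Rightarrow> complex) set" where
  "form_domain a V = {\<psi> \<in> L2.
     integrable lborel (\<lambda>k. a k * (cmod (L2_fourier \<psi> k))\<^sup>2) \<and>
     integrable lborel (\<lambda>x. V x * (cmod (\<psi> x))\<^sup>2)}"

definition form :: "(real^'n \<Rightarrow> real) \<Rightarrow> (real^'n \<Rightarrow> real) \<Rightarrow> real \<Rightarrow>
    (real^'n \<Rightarrow> complex) \<Rightarrow> (real^'n \<Rightarrow> complex) \<Rightarrow> complex" where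
  "form a V \<sigma> \<psi> \<phi> =
     (LINT k|lborel. of_real (a k) * L2_fourier \<psi> k * cnj (L2_fourier \<phi> k)) -
     of_real \<sigma> * (LINT x|lborel. of_real (V x) * \<psi> x * cnj (\<phi> x))"

text \<open>The operator \<open>H = A - \<sigma>V\<close> associated with the form.\<close>

definition hamiltonian :: "(real^'n \<Rightarrow> real) \<Rightarrow> (real^'n \<Rightarrow> real) \<Rightarrow> real \<Rightarrow> 'n::finite L2_op" where
  "hamiltonian a V \<sigma> = {(\<psi>, \<eta>). \<psi> \<in> form_domain a V \<and> \<eta> \<in> L2 \<and>
     (\<forall>\<phi>\<in>form_domain a V. form a V \<sigma> \<psi> \<phi> = L2_inner \<eta> \<phi>)}"

text \<open>
  Density of a set of functions in the form domain, with respect to the squared norm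
  \<open>\<parallel>\<psi>\<parallel>\<^sup>2 + \<integral> a |\<psi>^|\<^sup>2 + \<integral> |V| |\<psi>|\<^sup>2\<close>.
\<close>

definition form_core :: "(real^'n \<Rightarrow> real) \<Rightarrow> (real^'n \<Rightarrow> real) \<Rightarrow> (real^'n \<Rightarrow> complex) set \<Rightarrow> bool" where
  "form_core a V D \<longleftrightarrow> D \<subseteq> form_domain a V \<and>
     (\<forall>\<phi>\<in>form_domain a V. \<forall>\<epsilon>>0. \<exists>\<psi>\<in>D.
        (LINT x|lborel. (cmod (\<psi> x - \<phi> x))\<^sup>2) +
        (LINT k|lborel. a k * (cmod (L2_fourier \<psi> k - L2_fourier \<phi> k))\<^sup>2) +
        (LINT x|lborel. \<bar>V x\<bar> * (cmod (\<psi> x - \<phi> x))\<^sup>2) < \<epsilon>)"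

text \<open>
  \<open>A - \<sigma>V\<close> makes sense as a self-adjoint operator: the operator associated with the form is
  self-adjoint and determines the form (its domain is a form core). If the form is
  closed and bounded below, both hold by Kato's first representation theorem (the norm above is then
  equivalent to the form norm); semiboundedness is not required, so that for instance
  bounded \<open>a\<close> with arbitrary \<open>V\<close> in \<open>L\<^sup>1\<close> is covered.
\<close>

definition well_defined_hamiltonian ::
    "(real^'n \<Rightarrow> real) \<Rightarrow> (real^'n \<Rightarrow> real) \<Rightarrow> real \<Rightarrow> bool" where
  "well_defined_hamiltonian a V \<sigma> \<longleftrightarrow>
     self_adjoint (hamiltonian a V \<sigma>) \<and> form_core a V (Domain (hamiltonian a V \<sigma>))"

end

theory Submission imports Defs "HOL-Probability.Characteristic_Functions"
begin

text \<open>
  The proof is variational. Write \<open>E(\<psi>) = \<integral> a |\<psi>^|\<^sup>2 - \<sigma> \<integral> V |\<psi>|\<^sup>2\<close> for the quadratic form of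
  \<open>H = A - \<sigma>V\<close>.

  If \<open>H\<close> has no negative spectrum, then \<open>E \<ge> 0\<close> on the whole form domain. On the domain of \<open>H\<close>
  this is the statement that a self-adjoint operator with spectrum in \<open>[0,\<infinity>)\<close> is nonnegative
  (\<open>self_adjoint_nonneg\<close>), which holds for the following reason: the norm of the
  resolvent at \<open>\<mu>\<close> is the inverse distance of \<open>\<mu>\<close> to the spectrum
  (\<open>resolvent_bound_improvable\<close>), so \<open>\<nu> \<parallel>f\<parallel> \<le> \<parallel>(H + \<nu>) f\<parallel>\<close> for every \<open>\<nu> > 0\<close>, and expanding the
  square and letting \<open>\<nu> \<rightarrow> \<infinity>\<close> gives \<open>(H f, f) \<ge> 0\<close>. From the domain of \<open>H\<close> the inequality passes to
  the form domain because the former is a form core (\<open>energy_nonneg_if_nonneg_on_core\<close>).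

  On the other hand there are functions in the form domain with \<open>E < 0\<close>
  (\<open>negative_energy_exists\<close>). Near \<open>0\<close> the symbol is at most \<open>C|k|\<^sup>d\<close>, and \<open>\<integral> |k|\<^sup>-\<^sup>d dk\<close>
  diverges logarithmically at the origin. A truncation of \<open>|k|\<^sup>-\<^sup>d\<close>, normalised to integral 1, is
  therefore a probability density \<open>F\<close> supported in an arbitrarily small ball whose kinetic energy
  \<open>\<integral> a F\<^sup>2 \<le> C \<integral> |k|\<^sup>d F\<^sup>2\<close> is arbitrarily small. As the supports shrink to \<open>0\<close>, the inverse
  Fourier transform of \<open>F\<close> stays bounded and tends pointwise to the constant
  \<open>(2\<pi>)\<^sup>-\<^sup>d\<^sup>/\<^sup>2\<close>, so the potential energy tends to \<open>- \<sigma> (2\<pi>)\<^sup>-\<^sup>d \<integral> V < 0\<close>. Taking \<open>F\<close>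
  compactly supported is essential, as nothing restricts the growth of \<open>a\<close> at infinity.

  To connect the two halves, the \<open>L\<^sup>2\<close> Fourier transform is developed as far as needed. Damping
  with a Gaussian turns the inverse transform into an average against a Gaussian kernel
  (\<open>fourier_damped_inverse\<close>). This one identity yields both Bessel's inequality
  \<open>\<parallel>f^\<parallel> \<le> \<parallel>f\<parallel>\<close> (\<open>fourier_Bessel\<close>), hence existence of the transform on \<open>L\<^sup>2\<close>, and the inversion
  formula for the functions \<open>F\<close> above (\<open>L2_fourier_inversion\<close>).
\<close>

section \<open>Square integrable functions\<close>

lemma borel_measurable_cnj [measurable (raw)]:
  "f \<in> borel_measurable M \<Longrightarrow> (\<lambda>x. cnj (f x)) \<in> borel_measurable M"
  by (rule borel_measurable_continuous_on) (auto intro!: continuous_intros)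

lemma L2_measurable: "f \<in> L2 \<Longrightarrow> f \<in> borel_measurable borel"
  by (simp add: L2_def)

lemma L2_integrable_square: "f \<in> L2 \<Longrightarrow> integrable lborel (\<lambda>x. (cmod (f x))\<^sup>2)"
  by (simp add: L2_def)

lemma L2_norm_nonneg [simp]: "0 \<le> L2_norm f"
  by (simp add: L2_norm_def)

lemma L2_norm_square: "(L2_norm f)\<^sup>2 = (LINT x|lborel. (cmod (f x))\<^sup>2)"
  by (simp add: L2_norm_def)

lemma L2_integrable_mult:
  assumes "f \<in> L2" "g \<in> L2"
  shows "integrable lborel (\<lambda>x. f x * cnj (g x))"
proof (rule Bochner_Integration.integrable_bound)
  show "integrable lborel (\<lambda>x. (cmod (f x))\<^sup>2 + (cmod (g x))\<^sup>2)"
    using assms by (intro Bochner_Integration.integrable_add L2_integrable_square)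
  have [measurable]: "f \<in> borel_measurable borel" "g \<in> borel_measurable borel"
    using assms by (auto intro: L2_measurable)
  show "(\<lambda>x. f x * cnj (g x)) \<in> borel_measurable lborel"
    by measurable
  have "cmod (f x) * cmod (g x) \<le> (cmod (f x))\<^sup>2 + (cmod (g x))\<^sup>2" for x
  proof -
    have "0 \<le> cmod (f x) * cmod (g x)" by simp
    then show ?thesis using sum_squares_bound[of "cmod (f x)" "cmod (g x)"] by linarith
  qed
  then show "AE x in lborel. norm (f x * cnj (g x)) \<le> norm ((cmod (f x))\<^sup>2 + (cmod (g x))\<^sup>2)"
    by (auto simp: norm_mult)
qed

lemma L2_add_scale:
  assumes "f \<in> L2" "g \<in> L2"
  shows "(\<lambda>x. f x + of_real s * g x) \<in> L2"
proof -
  have [measurable]: "f \<in> borel_measurable borel" "g \<in> borel_measurable borel"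
    using assms by (auto intro: L2_measurable)
  have "integrable lborel (\<lambda>x. (cmod (f x + of_real s * g x))\<^sup>2)"
  proof (rule Bochner_Integration.integrable_bound)
    show "integrable lborel (\<lambda>x. 2 * (cmod (f x))\<^sup>2 + 2 * s\<^sup>2 * (cmod (g x))\<^sup>2)"
      using assms by (intro Bochner_Integration.integrable_add integrable_mult_right L2_integrable_square)
    have "(cmod (f x + of_real s * g x))\<^sup>2 \<le> 2 * (cmod (f x))\<^sup>2 + 2 * s\<^sup>2 * (cmod (g x))\<^sup>2" for x
    proof -
      have "cmod (f x + of_real s * g x) \<le> cmod (f x) + \<bar>s\<bar> * cmod (g x)"
        by (metis norm_mult norm_of_real norm_triangle_ineq)
      then have "(cmod (f x + of_real s * g x))\<^sup>2 \<le> (cmod (f x) + \<bar>s\<bar> * cmod (g x))\<^sup>2"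
        by (simp add: power_mono)
      also have "\<dots> \<le> 2 * (cmod (f x))\<^sup>2 + 2 * (\<bar>s\<bar> * cmod (g x))\<^sup>2"
        using sum_squares_bound[of "cmod (f x)" "\<bar>s\<bar> * cmod (g x)"] by (simp add: power2_sum)
      finally show ?thesis by (simp add: power_mult_distrib)
    qed
    then show "AE x in lborel. norm ((cmod (f x + of_real s * g x))\<^sup>2)
        \<le> norm (2 * (cmod (f x))\<^sup>2 + 2 * s\<^sup>2 * (cmod (g x))\<^sup>2)"
      by auto
  qed simp
  then show ?thesis by (simp add: L2_def)
qed

lemma L2_inner_commute: "L2_inner g f = cnj (L2_inner f g)"
proof -
  have "cnj (L2_inner f g) = (LINT x|lborel. cnj (f x * cnj (g x)))"
    unfolding L2_inner_def by (rule Bochner_Integration.integral_cnj[symmetric])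
  then show ?thesis by (simp add: L2_inner_def mult.commute)
qed

lemma L2_inner_add_scale_left:
  assumes "f \<in> L2" "g \<in> L2" "h \<in> L2"
  shows "L2_inner (\<lambda>x. f x + of_real s * g x) h = L2_inner f h + of_real s * L2_inner g h"
proof -
  have "L2_inner (\<lambda>x. f x + of_real s * g x) h
      = (LINT x|lborel. f x * cnj (h x) + of_real s * (g x * cnj (h x)))"
    unfolding L2_inner_def by (simp add: algebra_simps)
  also have "\<dots> = L2_inner f h + of_real s * L2_inner g h"
    unfolding L2_inner_def using assms
    by (subst Bochner_Integration.integral_add) (auto intro: L2_integrable_mult)
  finally show ?thesis .
qed

lemma L2_inner_add_scale_right:
  assumes "f \<in> L2" "g \<in> L2" "h \<in> L2"
  shows "L2_inner h (\<lambda>x. f x + of_real s * g x) = L2_inner h f + of_real s * L2_inner h g"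
  using L2_inner_add_scale_left[OF assms, of s] L2_inner_commute
  by (metis complex_cnj_add complex_cnj_complex_of_real complex_cnj_mult)

lemma L2_inner_self: "L2_inner f f = of_real ((L2_norm f)\<^sup>2)"
proof -
  have "L2_inner f f = (LINT x|lborel. complex_of_real ((cmod (f x))\<^sup>2))"
    unfolding L2_inner_def by (simp only: complex_norm_square)
  also have "\<dots> = of_real (LINT x|lborel. (cmod (f x))\<^sup>2)"
    by (rule integral_complex_of_real)
  finally show ?thesis by (simp only: L2_norm_square)
qed

lemma L2_norm_add_scale_square:
  assumes "f \<in> L2" "g \<in> L2"
  shows "(L2_norm (\<lambda>x. f x + of_real s * g x))\<^sup>2
    = (L2_norm f)\<^sup>2 + 2 * s * Re (L2_inner f g) + s\<^sup>2 * (L2_norm g)\<^sup>2"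
proof -
  let ?h = "\<lambda>x. f x + of_real s * g x"
  have h: "?h \<in> L2" using assms by (rule L2_add_scale)
  have "complex_of_real ((L2_norm ?h)\<^sup>2) = L2_inner f ?h + of_real s * L2_inner g ?h"
    by (subst L2_inner_self[symmetric]) (rule L2_inner_add_scale_left[OF assms h])
  also have "\<dots> = L2_inner f f + of_real s * L2_inner f g
      + of_real s * (L2_inner g f + of_real s * L2_inner g g)"
    using assms by (simp add: L2_inner_add_scale_right)
  finally have "(L2_norm ?h)\<^sup>2 = Re (L2_inner f f + of_real s * L2_inner f g
      + of_real s * (L2_inner g f + of_real s * L2_inner g g))"
    by (metis Re_complex_of_real)
  moreover have "Re (L2_inner g f) = Re (L2_inner f g)"
    by (subst L2_inner_commute) simp
  ultimately show ?thesis
    by (simp add: L2_inner_self power2_eq_square algebra_simps)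
qed

lemma L2_Cauchy_Schwarz:
  assumes "f \<in> L2" "g \<in> L2"
  shows "Re (L2_inner f g) \<le> L2_norm f * L2_norm g"
proof -
  let ?r = "Re (L2_inner f g)"
  have pos: "0 \<le> (L2_norm f)\<^sup>2 + 2 * s * ?r + s\<^sup>2 * (L2_norm g)\<^sup>2" for s
    using L2_norm_add_scale_square[OF assms, of s] by (metis zero_le_power2)
  have "?r\<^sup>2 \<le> (L2_norm f * L2_norm g)\<^sup>2"
  proof (cases "L2_norm g = 0")
    case True
    have "?r = 0"
    proof (rule ccontr)
      assume "?r \<noteq> 0"
      then show False
        using pos[of "- ((L2_norm f)\<^sup>2 + 1) / (2 * ?r)"] True by (simp add: field_simps)
    qed
    then show ?thesis by simp
  next
    case False
    have "0 \<le> (L2_norm f)\<^sup>2 - ?r\<^sup>2 / (L2_norm g)\<^sup>2"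
      using pos[of "- ?r / (L2_norm g)\<^sup>2"] False by (simp add: field_simps power2_eq_square)
    then show ?thesis using False by (simp add: field_simps power_mult_distrib)
  qed
  then show ?thesis
    by (rule power2_le_imp_le) simp
qed

section \<open>Self-adjoint operators without negative spectrum are nonnegative\<close>

lemma self_adjoint_L2:
  assumes "adjoint_op T = T" "(f, f') \<in> T"
  shows "f \<in> L2" "f' \<in> L2"
proof -
  have "(f, f') \<in> adjoint_op T" using assms by simp
  then show "f \<in> L2" "f' \<in> L2" by (auto simp: adjoint_op_def)
qed

lemma self_adjoint_symmetric:
  assumes "adjoint_op T = T" "(f, f') \<in> T" "(g, g') \<in> T"
  shows "L2_inner f' g = L2_inner f g'"
proof -
  have "(g, g') \<in> adjoint_op T" using assms by simp
  then show ?thesis using assms(2) by (auto simp: adjoint_op_def)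
qed

text \<open>
  The graph of an adjoint is a linear subspace, and it is closed under almost everywhere equality;
  both properties pass to a graph that equals its adjoint.
\<close>

lemma self_adjoint_add_scale:
  assumes T: "adjoint_op T = T" and f: "(f, f') \<in> T" and g: "(g, g') \<in> T"
  shows "(\<lambda>x. f x + of_real s * g x, \<lambda>x. f' x + of_real s * g' x) \<in> T"
proof -
  note L = self_adjoint_L2[OF T]
  have "(\<lambda>x. f x + of_real s * g x, \<lambda>x. f' x + of_real s * g' x) \<in> adjoint_op T"
    unfolding adjoint_op_def using L[OF f] L[OF g]
    by (auto simp: L2_add_scale L2_inner_add_scale_right L
          self_adjoint_symmetric[OF T _ f] self_adjoint_symmetric[OF T _ g])
  then show ?thesis using T by simp
qed

lemma self_adjoint_cong_AE:
  assumes T: "adjoint_op T = T" and f: "(f, f') \<in> T" and h: "h \<in> L2"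
    and eq: "AE x in lborel. f' x = h x"
  shows "(f, h) \<in> T"
proof -
  note L = self_adjoint_L2[OF T]
  have "L2_inner g f' = L2_inner g h" if "g \<in> L2" for g
    unfolding L2_inner_def using L2_measurable[OF L(2)[OF f]] L2_measurable[OF h] L2_measurable[OF that] eq
    by (intro integral_cong_AE) auto
  then have "(f, h) \<in> adjoint_op T"
    unfolding adjoint_op_def using L[OF f] h
    by (auto simp: self_adjoint_symmetric[OF T _ f] L(1))
  then show ?thesis using T by simp
qed

lemma resolvent_bound:
  assumes "complex_of_real \<mu> \<in> resolvent_set T"
  obtains M where "M \<ge> 0"
    "\<And>f f'. (f, f') \<in> T \<Longrightarrow> L2_norm f \<le> M * L2_norm (\<lambda>x. f' x + of_real (- \<mu>) * f x)"
proof -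
  obtain M where M: "\<forall>(f, f')\<in>T. L2_norm f \<le> M * L2_norm (\<lambda>x. f' x - of_real \<mu> * f x)"
    using assms by (auto simp: resolvent_set_def)
  show ?thesis
  proof (rule that[of "max M 0"])
    fix f f' assume "(f, f') \<in> T"
    then have "L2_norm f \<le> M * L2_norm (\<lambda>x. f' x - of_real \<mu> * f x)"
      using M by auto
    also have "\<dots> \<le> max M 0 * L2_norm (\<lambda>x. f' x - of_real \<mu> * f x)"
      by (intro mult_right_mono) auto
    finally show "L2_norm f \<le> max M 0 * L2_norm (\<lambda>x. f' x + of_real (- \<mu>) * f x)"
      by simp
  qed simp
qed

lemma resolvent_surj:
  assumes T: "adjoint_op T = T" and "complex_of_real \<mu> \<in> resolvent_set T" and g: "g \<in> L2"
  obtains f where "(f, \<lambda>x. g x + of_real \<mu> * f x) \<in> T"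
proof -
  obtain f f' where f: "(f, f') \<in> T" and "AE x in lborel. f' x - of_real \<mu> * f x = g x"
    using assms(2) g by (fastforce simp: resolvent_set_def)
  then have "AE x in lborel. f' x = g x + of_real \<mu> * f x"
    by (auto simp: algebra_simps)
  with f show ?thesis
    by (intro that[of f] self_adjoint_cong_AE[OF T f] L2_add_scale g self_adjoint_L2(1)[OF T f])
qed

text \<open>
  For bounded self-adjoint \<open>R\<close>, at least one of \<open>\<parallel>R\<parallel>\<close> and \<open>- \<parallel>R\<parallel>\<close> is in the spectrum; here \<open>R\<close> is
  the resolvent of \<open>T\<close> at \<open>\<mu>\<close>, with \<open>\<parallel>R\<parallel> \<le> K\<close>, and \<open>\<mu> \<plusminus> 1/K\<close> are the points of the spectrum of \<open>T\<close>
  that correspond to \<open>\<plusminus>K\<close>. With \<open>m = 1/K\<close>, \<open>h = R g\<close> and \<open>f = R h\<close>,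
  \<open>(T - \<mu> - m) (T - \<mu> + m) f = g - m\<^sup>2 f\<close>, and the norm of the right-hand side is at most
  \<open>(\<parallel>g\<parallel>\<^sup>2 - m\<^sup>2 \<parallel>h\<parallel>\<^sup>2)\<^sup>1\<^sup>/\<^sup>2\<close>, which is small against \<open>\<parallel>g\<parallel>\<close> if \<open>\<parallel>R g\<parallel>\<close> almost attains the bound
  \<open>K \<parallel>g\<parallel>\<close>. If \<open>\<mu> \<plusminus> m\<close> are both in the resolvent set, then \<open>f\<close> is small as well, in contradiction
  to \<open>\<parallel>h\<parallel>\<^sup>2 = (g, f)\<close>. So in that case \<open>K\<close> is not the least bound.
\<close>

lemma resolvent_bound_improvable:
  assumes T: "adjoint_op T = T" and K: "K > 0"
    and res: "complex_of_real \<mu> \<in> resolvent_set T"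
    and resp: "complex_of_real (\<mu> + 1 / K) \<in> resolvent_set T"
    and resm: "complex_of_real (\<mu> - 1 / K) \<in> resolvent_set T"
    and bound: "\<And>f f'. (f, f') \<in> T \<Longrightarrow> L2_norm f \<le> K * L2_norm (\<lambda>x. f' x + of_real (- \<mu>) * f x)"
  obtains L where "0 \<le> L" "L < K"
    "\<And>f f'. (f, f') \<in> T \<Longrightarrow> L2_norm f \<le> L * L2_norm (\<lambda>x. f' x + of_real (- \<mu>) * f x)"
proof -
  define m where "m = 1 / K"
  have m: "m > 0" "m * K = 1" using K by (auto simp: m_def)
  obtain Mp where Mp: "Mp \<ge> 0"
    "\<And>f f'. (f, f') \<in> T \<Longrightarrow> L2_norm f \<le> Mp * L2_norm (\<lambda>x. f' x + of_real (- (\<mu> + m)) * f x)"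
    using resolvent_bound[OF resp[folded m_def]] by blast
  obtain Mm where Mm: "Mm \<ge> 0"
    "\<And>f f'. (f, f') \<in> T \<Longrightarrow> L2_norm f \<le> Mm * L2_norm (\<lambda>x. f' x + of_real (- (\<mu> - m)) * f x)"
    using resolvent_bound[OF resm[folded m_def]] by blast
  define q where "q = Mm * Mp"
  have q: "0 \<le> q" using Mp Mm by (simp add: q_def)
  \<comment> \<open>In terms of the resolvent \<open>R\<close>: \<open>\<parallel>R g\<parallel>\<^sup>4 \<le> \<parallel>g\<parallel>\<^sup>2 \<parallel>R\<^sup>2 g\<parallel>\<^sup>2\<close>, where \<open>\<parallel>R\<^sup>2 g\<parallel>\<close> is bounded by way of \<open>\<mu> \<plusminus> m\<close>.\<close>
  have key: "(L2_norm h)\<^sup>2 * (L2_norm h)\<^sup>2 \<le> (L2_norm g)\<^sup>2 * (q\<^sup>2 * ((L2_norm g)\<^sup>2 - m\<^sup>2 * (L2_norm h)\<^sup>2))"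
    if h: "(h, h') \<in> T" and gdef: "g = (\<lambda>x. h' x + of_real (- \<mu>) * h x)" for h h' g
  proof -
    have hL: "h \<in> L2" "h' \<in> L2" using self_adjoint_L2[OF T h] by auto
    have gL: "g \<in> L2" unfolding gdef by (intro L2_add_scale hL)
    obtain f where f: "(f, \<lambda>x. h x + of_real \<mu> * f x) \<in> T"
      using resolvent_surj[OF T res hL(1)] .
    have fL: "f \<in> L2" using self_adjoint_L2[OF T f] by auto
    have "L2_inner g f = L2_inner h' f + of_real (- \<mu>) * L2_inner h f"
      unfolding gdef by (rule L2_inner_add_scale_left[OF hL(2,1) fL])
    also have "L2_inner h' f = L2_inner h (\<lambda>x. h x + of_real \<mu> * f x)"
      by (rule self_adjoint_symmetric[OF T h f])
    also have "\<dots> = L2_inner h h + of_real \<mu> * L2_inner h f"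
      by (rule L2_inner_add_scale_right[OF hL(1) fL hL(1)])
    finally have gf: "Re (L2_inner g f) = (L2_norm h)\<^sup>2"
      by (simp add: L2_inner_self)
    define u where "u = (\<lambda>x. h x + of_real m * f x)"
    define w where "w = (\<lambda>x. g x + of_real (- m\<^sup>2) * f x)"
    have u: "(u, \<lambda>x. h' x + of_real m * (h x + of_real \<mu> * f x)) \<in> T"
      unfolding u_def by (rule self_adjoint_add_scale[OF T h f])
    have "(\<lambda>x. (h' x + of_real m * (h x + of_real \<mu> * f x)) + of_real (- (\<mu> + m)) * u x) = w"
      by (auto simp: w_def u_def gdef fun_eq_iff algebra_simps power2_eq_square)
    then have 1: "L2_norm u \<le> Mp * L2_norm w" using Mp(2)[OF u] by simp
    have "(\<lambda>x. (h x + of_real \<mu> * f x) + of_real (- (\<mu> - m)) * f x) = u"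
      by (auto simp: u_def fun_eq_iff algebra_simps)
    then have 2: "L2_norm f \<le> Mm * L2_norm u" using Mm(2)[OF f] by simp
    have 3: "L2_norm f \<le> q * L2_norm w"
      using 2 mult_left_mono[OF 1 Mm(1)] by (simp add: q_def mult.assoc)
    have "L2_norm f \<le> K * L2_norm h"
      using bound[OF f] by (simp add: algebra_simps)
    then have "m * L2_norm f \<le> L2_norm h"
      using K by (simp add: m_def field_simps)
    then have "(m * L2_norm f)\<^sup>2 \<le> (L2_norm h)\<^sup>2"
      using m by (intro power_mono) auto
    then have mf: "m\<^sup>2 * (m\<^sup>2 * (L2_norm f)\<^sup>2) \<le> m\<^sup>2 * (L2_norm h)\<^sup>2"
      by (intro mult_left_mono) (auto simp: power_mult_distrib)
    have "(L2_norm w)\<^sup>2 = (L2_norm g)\<^sup>2 + 2 * (- m\<^sup>2) * Re (L2_inner g f) + (- m\<^sup>2)\<^sup>2 * (L2_norm f)\<^sup>2"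
      unfolding w_def by (rule L2_norm_add_scale_square[OF gL fL])
    also have "\<dots> \<le> (L2_norm g)\<^sup>2 - m\<^sup>2 * (L2_norm h)\<^sup>2"
      using mf by (simp add: gf power2_eq_square algebra_simps)
    finally have w: "(L2_norm w)\<^sup>2 \<le> (L2_norm g)\<^sup>2 - m\<^sup>2 * (L2_norm h)\<^sup>2" .
    have "(L2_norm f)\<^sup>2 \<le> (q * L2_norm w)\<^sup>2" using 3 by (intro power_mono) auto
    also have "\<dots> \<le> q\<^sup>2 * ((L2_norm g)\<^sup>2 - m\<^sup>2 * (L2_norm h)\<^sup>2)"
      using w by (simp add: power_mult_distrib mult_left_mono)
    finally have f2: "(L2_norm f)\<^sup>2 \<le> q\<^sup>2 * ((L2_norm g)\<^sup>2 - m\<^sup>2 * (L2_norm h)\<^sup>2)" .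
    have "(L2_norm h)\<^sup>2 \<le> L2_norm g * L2_norm f"
      using L2_Cauchy_Schwarz[OF gL fL] gf by simp
    then have "((L2_norm h)\<^sup>2)\<^sup>2 \<le> (L2_norm g * L2_norm f)\<^sup>2" by (intro power_mono) auto
    also have "\<dots> \<le> (L2_norm g)\<^sup>2 * (q\<^sup>2 * ((L2_norm g)\<^sup>2 - m\<^sup>2 * (L2_norm h)\<^sup>2))"
      using f2 by (simp add: power_mult_distrib mult_left_mono)
    finally show ?thesis by (simp add: power2_eq_square)
  qed
  \<comment> \<open>Small enough that \<open>\<parallel>h\<parallel>\<^sup>2 > K\<^sup>2 (1 - \<delta>) \<parallel>g\<parallel>\<^sup>2\<close> contradicts \<open>key\<close>.\<close>
  define \<delta> where "\<delta> = K^4 / (4 * (q\<^sup>2 + K^4))"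
  have D: "q\<^sup>2 + K^4 > 0" using K by (simp add: add_nonneg_pos)
  have \<delta>: "0 < \<delta>" "\<delta> \<le> 1/4"
    using K D by (auto simp: \<delta>_def divide_simps)
  have "q\<^sup>2 * \<delta> \<le> K^4 * (1/4)"
    using D K by (simp add: \<delta>_def divide_simps algebra_simps)
  also have "\<dots> \<le> K^4 * (1 - \<delta>)\<^sup>2"
    using \<delta> power_mono[of "1/2" "1 - \<delta>" 2] by (intro mult_left_mono) (auto simp: power2_eq_square)
  finally have q\<delta>: "q\<^sup>2 * \<delta> \<le> K^4 * (1 - \<delta>)\<^sup>2" .
  show ?thesis
  proof (rule that[of "K * sqrt (1 - \<delta>)"])
    show "0 \<le> K * sqrt (1 - \<delta>)" using K \<delta> by simp
    show "K * sqrt (1 - \<delta>) < K" using K \<delta> by simp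
    fix h h' assume h: "(h, h') \<in> T"
    define g where "g = (\<lambda>x. h' x + of_real (- \<mu>) * h x)"
    define H where "H = (L2_norm h)\<^sup>2"
    define G where "G = (L2_norm g)\<^sup>2"
    have nonneg: "0 \<le> H" "0 \<le> G" by (auto simp: H_def G_def)
    have key': "H * H \<le> G * (q\<^sup>2 * (G - m\<^sup>2 * H))"
      unfolding H_def G_def by (rule key[OF h g_def])
    have "H \<le> K\<^sup>2 * (1 - \<delta>) * G"
    proof (rule ccontr)
      assume "\<not> ?thesis"
      then have less: "K\<^sup>2 * (1 - \<delta>) * G < H" by simp
      have "m\<^sup>2 * (K\<^sup>2 * (1 - \<delta>) * G) \<le> m\<^sup>2 * H"
        using less by (intro mult_left_mono) auto
      moreover have "m\<^sup>2 * (K\<^sup>2 * (1 - \<delta>) * G) = (m * K)\<^sup>2 * ((1 - \<delta>) * G)"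
        by (simp add: power_mult_distrib)
      ultimately have "(1 - \<delta>) * G \<le> m\<^sup>2 * H"
        by (simp only: m(2) power_one mult_1)
      then have "G - m\<^sup>2 * H \<le> \<delta> * G"
        by (simp add: algebra_simps)
      then have "G * (q\<^sup>2 * (G - m\<^sup>2 * H)) \<le> G * (q\<^sup>2 * (\<delta> * G))"
        using nonneg by (intro mult_left_mono) auto
      also have "\<dots> = (q\<^sup>2 * \<delta>) * G\<^sup>2" by (simp add: power2_eq_square)
      also have "\<dots> \<le> (K^4 * (1 - \<delta>)\<^sup>2) * G\<^sup>2"
        using q\<delta> by (intro mult_right_mono) auto
      also have "\<dots> = (K\<^sup>2 * (1 - \<delta>) * G)\<^sup>2"
        by (simp add: power_mult_distrib flip: power_mult)
      also have "\<dots> < H\<^sup>2"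
        using less nonneg \<delta> by (intro power_strict_mono) auto
      finally show False using key' by (simp add: power2_eq_square)
    qed
    then have "H \<le> (K * sqrt (1 - \<delta>) * L2_norm g)\<^sup>2"
      using \<delta> by (simp add: G_def power_mult_distrib)
    moreover have "0 \<le> K * sqrt (1 - \<delta>) * L2_norm g" using K \<delta> by simp
    ultimately have "L2_norm h \<le> K * sqrt (1 - \<delta>) * L2_norm g"
      unfolding H_def by (rule power2_le_imp_le)
    then show "L2_norm h \<le> K * sqrt (1 - \<delta>) * L2_norm (\<lambda>x. h' x + of_real (- \<mu>) * h x)"
      by (simp only: g_def)
  qed
qed

text \<open>
  Let \<open>K\<close> be the least bound for the inverse of \<open>T + \<nu>\<close>. If \<open>K\<close> were greater than \<open>1/\<nu>\<close>, then
  \<open>-\<nu> + 1/K\<close> and \<open>-\<nu> - 1/K\<close> would both be negative, hence in the resolvent set, and \<open>K\<close> could be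
  improved.
\<close>

lemma resolvent_bound_distance:
  assumes T: "adjoint_op T = T" and \<nu>: "\<nu> > 0"
    and res: "\<And>\<mu>. \<mu> < 0 \<Longrightarrow> complex_of_real \<mu> \<in> resolvent_set T"
    and f: "(f, f') \<in> T"
  shows "\<nu> * L2_norm f \<le> L2_norm (\<lambda>x. f' x + of_real \<nu> * f x)"
proof -
  define B where "B = {K. 0 \<le> K \<and> (\<forall>f f'. (f, f') \<in> T \<longrightarrow> L2_norm f \<le> K * L2_norm (\<lambda>x. f' x + of_real \<nu> * f x))}"
  define K where "K = Inf B"
  have "complex_of_real (- \<nu>) \<in> resolvent_set T" using \<nu> by (intro res) simp
  then obtain M where "0 \<le> M"
    "\<And>f f'. (f, f') \<in> T \<Longrightarrow> L2_norm f \<le> M * L2_norm (\<lambda>x. f' x + of_real (- (- \<nu>)) * f x)"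
    by (rule resolvent_bound) blast
  then have "M \<in> B" by (simp add: B_def)
  then have ne: "B \<noteq> {}" by auto
  have bdd: "bdd_below B" by (auto simp: B_def)
  have K0: "0 \<le> K" unfolding K_def using ne by (intro cInf_greatest) (auto simp: B_def)
  have bound: "L2_norm f \<le> K * L2_norm (\<lambda>x. f' x + of_real \<nu> * f x)" if "(f, f') \<in> T" for f f'
  proof (cases "L2_norm (\<lambda>x. f' x + of_real \<nu> * f x) = 0")
    case True
    then show ?thesis using \<open>M \<in> B\<close> that by (fastforce simp: B_def)
  next
    case False
    then have pos: "0 < L2_norm (\<lambda>x. f' x + of_real \<nu> * f x)"
      by (simp add: order_less_le)
    have "L2_norm f / L2_norm (\<lambda>x. f' x + of_real \<nu> * f x) \<le> K"
      unfolding K_def using ne that pos by (intro cInf_greatest) (auto simp: B_def pos_divide_le_eq)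
    then show ?thesis using pos by (simp add: pos_divide_le_eq)
  qed
  have "K \<le> 1 / \<nu>"
  proof (rule ccontr)
    assume "\<not> K \<le> 1 / \<nu>"
    then have less: "1 / \<nu> < K" by simp
    have K: "K > 0" using \<nu> less less_trans[of 0 "1 / \<nu>" K] by simp
    have "1 / K < \<nu>" using less K \<nu> by (simp add: field_simps)
    moreover have "0 < 1 / K" using K by simp
    ultimately have neg: "- \<nu> < 0" "- \<nu> + 1 / K < 0" "- \<nu> - 1 / K < 0"
      using \<nu> by linarith+
    obtain L where L: "0 \<le> L" "L < K"
      "\<And>f f'. (f, f') \<in> T \<Longrightarrow> L2_norm f \<le> L * L2_norm (\<lambda>x. f' x + of_real (- (- \<nu>)) * f x)"
      using resolvent_bound_improvable[OF T K res[OF neg(1)] res[OF neg(2)] res[OF neg(3)]] bound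
      unfolding minus_minus by blast
    then have "L \<in> B" by (auto simp: B_def)
    then have "K \<le> L" unfolding K_def by (rule cInf_lower[OF _ bdd])
    then show False using L(2) by simp
  qed
  then have "K * L2_norm (\<lambda>x. f' x + of_real \<nu> * f x) \<le> 1 / \<nu> * L2_norm (\<lambda>x. f' x + of_real \<nu> * f x)"
    by (intro mult_right_mono) auto
  with bound[OF f] have "L2_norm f \<le> 1 / \<nu> * L2_norm (\<lambda>x. f' x + of_real \<nu> * f x)"
    by linarith
  then show ?thesis using \<nu> by (simp add: field_simps)
qed

text \<open>
  Squaring \<open>\<nu> \<parallel>f\<parallel> \<le> \<parallel>T f + \<nu> f\<parallel>\<close> gives \<open>0 \<le> \<parallel>T f\<parallel>\<^sup>2 + 2 \<nu> Re (T f, f)\<close>, which is violated for large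
  \<open>\<nu>\<close> if \<open>Re (T f, f) < 0\<close>.
\<close>

theorem self_adjoint_nonneg:
  assumes T: "adjoint_op T = T"
    and res: "\<And>\<mu>. \<mu> < 0 \<Longrightarrow> complex_of_real \<mu> \<in> resolvent_set T"
    and f: "(f, f') \<in> T"
  shows "0 \<le> Re (L2_inner f' f)"
proof (rule ccontr)
  assume "\<not> ?thesis"
  then have neg: "Re (L2_inner f' f) < 0" by simp
  define r where "r = - Re (L2_inner f' f)"
  have r: "r > 0" using neg by (simp add: r_def)
  define \<nu> where "\<nu> = ((L2_norm f')\<^sup>2 + 1) / r"
  have \<nu>: "\<nu> > 0" using r by (simp add: \<nu>_def add_nonneg_pos)
  have "(\<nu> * L2_norm f)\<^sup>2 \<le> (L2_norm (\<lambda>x. f' x + of_real \<nu> * f x))\<^sup>2"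
    using resolvent_bound_distance[OF T \<nu> res f] \<nu> by (intro power_mono) auto
  also have "\<dots> = (L2_norm f')\<^sup>2 + 2 * \<nu> * Re (L2_inner f' f) + \<nu>\<^sup>2 * (L2_norm f)\<^sup>2"
    by (rule L2_norm_add_scale_square) (use self_adjoint_L2[OF T f] in auto)
  finally have "2 * (\<nu> * r) \<le> (L2_norm f')\<^sup>2"
    by (simp add: r_def power_mult_distrib)
  moreover have "\<nu> * r = (L2_norm f')\<^sup>2 + 1" using r by (simp add: \<nu>_def)
  ultimately show False using zero_le_power2[of "L2_norm f'"] by linarith
qed

section \<open>The Fourier transform of integrable functions\<close>

definition fourier :: "(real^'n \<Rightarrow> complex) \<Rightarrow> real^'n \<Rightarrow> complex" where
  "fourier f k = of_real ((2 * pi) powr (- real CARD('n) / 2)) *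
     (LINT x|lborel. f x * exp (- \<i> * of_real (k \<bullet> x)))"

text \<open>
  The standard Gaussian probability density on \<open>\<real>\<^sup>d\<close>; its unitary Fourier transform is itself.
\<close>

definition gauss :: "real^'n \<Rightarrow> real" where
  "gauss x = (2 * pi) powr (- real CARD('n) / 2) * exp (- (norm x)\<^sup>2 / 2)"

lemma lborel_integral_prod:
  fixes f :: "'a::euclidean_space \<Rightarrow> real \<Rightarrow> complex"
  assumes int: "\<And>b. b \<in> Basis \<Longrightarrow> integrable lborel (f b)"
  shows "integrable lborel (\<lambda>x. \<Prod>b\<in>Basis. f b (x \<bullet> b))"
    and "(LINT x|lborel. (\<Prod>b\<in>Basis. f b (x \<bullet> b))) = (\<Prod>b\<in>Basis. LINT t|lborel. f b t)"
proof -
  interpret product_sigma_finite "\<lambda>_::'a. lborel::real measure" ..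
  have [measurable]: "f b \<in> borel_measurable borel" if "b \<in> Basis" for b
    using borel_measurable_integrable[OF int[OF that]] by simp
  have eq: "(\<Prod>b\<in>Basis. f b ((\<Sum>c\<in>Basis. y c *\<^sub>R c) \<bullet> b)) = (\<Prod>b\<in>Basis. f b (y b))" for y :: "'a \<Rightarrow> real"
    by (intro prod.cong) simp_all
  have m: "(\<lambda>x::'a. \<Prod>b\<in>Basis. f b (x \<bullet> b)) \<in> borel_measurable borel"
    by (intro borel_measurable_prod) measurable
  show "integrable lborel (\<lambda>x::'a. \<Prod>b\<in>Basis. f b (x \<bullet> b))"
    by (subst lborel_eq, subst integrable_distr_eq)
       (auto simp: eq m intro!: product_integrable_prod int)
  show "(LINT x|lborel. (\<Prod>b\<in>Basis. f b (x \<bullet> b))) = (\<Prod>b\<in>Basis. LINT t|lborel. f b t)"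
    by (subst lborel_eq, subst integral_distr)
       (auto simp: eq m intro!: product_integral_prod int)
qed

lemma std_normal_char:
  fixes u :: real
  shows "integrable lborel (\<lambda>t. of_real (std_normal_density t) * exp (- \<i> * of_real (u * t)))"
    and "(LINT t|lborel. of_real (std_normal_density t) * exp (- \<i> * of_real (u * t))) = of_real (exp (- u\<^sup>2 / 2))"
proof -
  show "integrable lborel (\<lambda>t. complex_of_real (std_normal_density t) * exp (- \<i> * of_real (u * t)))"
  proof (rule Bochner_Integration.integrable_bound)
    show "integrable lborel std_normal_density" by simp
    show "AE t in lborel. norm (complex_of_real (std_normal_density t) * exp (- \<i> * of_real (u * t)))
        \<le> norm (std_normal_density t)"
      by (simp add: norm_mult)
  qed simp
  have "of_real (exp (- (- u)\<^sup>2 / 2)) = char std_normal_distribution (- u)"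
    by (simp add: char_std_normal_distribution)
  also have "\<dots> = (LINT t|lborel. std_normal_density t *\<^sub>R exp (\<i> * of_real (- u * t)))"
    unfolding char_def by (subst integral_density) auto
  finally show "(LINT t|lborel. of_real (std_normal_density t) * exp (- \<i> * of_real (u * t))) = of_real (exp (- u\<^sup>2 / 2))"
    by (simp add: scaleR_conv_of_real)
qed

text \<open>
  Both the density and the character factor over the coordinates, which reduces the transform of
  the Gaussian to the characteristic function of the one-dimensional normal distribution.
\<close>

lemma gauss_prod:
  fixes x k :: "real^'n"
  shows "of_real (gauss x) * exp (- \<i> * of_real (k \<bullet> x))
    = (\<Prod>b\<in>Basis. of_real (std_normal_density (x \<bullet> b)) * exp (- \<i> * of_real ((k \<bullet> b) * (x \<bullet> b))))"
proof -
  have "(2 * pi) powr (- real CARD('n) / 2) = ((2 * pi) powr (- 1 / 2)) powr (real CARD('n))"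
    by (simp add: powr_powr)
  also have "\<dots> = ((2 * pi) powr (- 1 / 2)) ^ CARD('n)"
    by (rule powr_realpow) simp
  also have "(2 * pi) powr (- 1 / 2) = 1 / sqrt (2 * pi)"
    by (simp add: powr_minus_divide powr_half_sqrt)
  finally have 1: "(2 * pi) powr (- real CARD('n) / 2) = (\<Prod>b\<in>(Basis::(real^'n) set). 1 / sqrt (2 * pi))"
    by simp
  have "(norm x)\<^sup>2 = (\<Sum>b\<in>Basis. (x \<bullet> b)\<^sup>2)"
    by (subst power2_norm_eq_inner, subst euclidean_inner) (simp add: power2_eq_square)
  then have 2: "exp (- (norm x)\<^sup>2 / 2) = (\<Prod>b\<in>Basis. exp (- (x \<bullet> b)\<^sup>2 / 2))"
    by (simp add: exp_sum[symmetric] sum_negf sum_divide_distrib)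
  have "k \<bullet> x = (\<Sum>b\<in>Basis. (k \<bullet> b) * (x \<bullet> b))" by (rule euclidean_inner)
  then have 3: "exp (- \<i> * of_real (k \<bullet> x)) = (\<Prod>b\<in>Basis. exp (- \<i> * of_real ((k \<bullet> b) * (x \<bullet> b))))"
    by (simp add: exp_sum[symmetric] sum_negf sum_distrib_left)
  show ?thesis
    unfolding gauss_def 1 2 3 std_normal_density_def
    by (simp only: of_real_mult of_real_prod prod.distrib)
qed

lemma gauss_char:
  fixes k :: "real^'n"
  shows "integrable lborel (\<lambda>x. of_real (gauss x) * exp (- \<i> * of_real (k \<bullet> x)))"
    and "(LINT x|lborel. of_real (gauss x) * exp (- \<i> * of_real (k \<bullet> x))) = of_real (exp (- (norm k)\<^sup>2 / 2))"
proof -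
  show "integrable lborel (\<lambda>x. of_real (gauss x) * exp (- \<i> * of_real (k \<bullet> x)))"
    unfolding gauss_prod by (rule lborel_integral_prod(1)) (rule std_normal_char)
  have "(LINT x|lborel. of_real (gauss x) * exp (- \<i> * of_real (k \<bullet> x)))
    = (\<Prod>b\<in>Basis. of_real (exp (- (k \<bullet> b)\<^sup>2 / 2)))"
    unfolding gauss_prod by (subst lborel_integral_prod(2)) (simp_all only: std_normal_char)
  also have "\<dots> = of_real (exp (\<Sum>b\<in>Basis. - (k \<bullet> b)\<^sup>2 / 2))"
    by (simp only: of_real_prod exp_sum finite_Basis)
  also have "(\<Sum>b\<in>Basis. - (k \<bullet> b)\<^sup>2 / 2) = - (norm k)\<^sup>2 / 2"
    by (subst power2_norm_eq_inner, subst euclidean_inner)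
      (simp add: power2_eq_square sum_negf sum_divide_distrib)
  finally show "(LINT x|lborel. of_real (gauss x) * exp (- \<i> * of_real (k \<bullet> x))) = of_real (exp (- (norm k)\<^sup>2 / 2))" .
qed

lemma gauss_nonneg: "0 \<le> gauss x" by (simp add: gauss_def)

lemma gauss_integral:
  "integrable lborel (gauss :: real^'n \<Rightarrow> real)" "(LINT x|lborel. gauss (x::real^'n)) = 1"
proof -
  have "integrable lborel (\<lambda>x::real^'n. complex_of_real (gauss x))"
    using gauss_char(1)[of "0::real^'n"] by simp
  from integrable_Re[OF this] show "integrable lborel (gauss :: real^'n \<Rightarrow> real)"
    by (simp only: Re_complex_of_real)
  have "complex_of_real (LINT x|lborel. gauss (x::real^'n)) = 1"
    using gauss_char(2)[of "0::real^'n"] by simp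
  then show "(LINT x|lborel. gauss (x::real^'n)) = 1" by (simp only: of_real_eq_1_iff)
qed

lemma lborel_integral_affine:
  fixes f :: "real^'n \<Rightarrow> complex"
  assumes "s \<noteq> 0"
  shows "(LINT x|lborel. f x) = \<bar>s\<bar> ^ CARD('n) *\<^sub>R (LINT x|lborel. f (t + s *\<^sub>R x))"
    and "integrable lborel f \<Longrightarrow> integrable lborel (\<lambda>x. f (t + s *\<^sub>R x))"
proof -
  have *: "f \<in> borel_measurable borel" if "integrable lborel (\<lambda>x. f (t + s *\<^sub>R x))"
  proof -
    have [measurable]: "(\<lambda>x. f (t + s *\<^sub>R x)) \<in> borel_measurable borel"
      using borel_measurable_integrable[OF that] by simp
    have "(\<lambda>y. (\<lambda>x. f (t + s *\<^sub>R x)) ((1 / s) *\<^sub>R (y - t))) \<in> borel_measurable borel"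
      by (rule measurable_compose[where N=borel and f="\<lambda>y. (1 / s) *\<^sub>R (y - t)"]) measurable
    then show ?thesis using assms by simp
  qed
  have A: "lborel = density (distr lborel borel (\<lambda>x::real^'n. t + s *\<^sub>R x)) (\<lambda>_. \<bar>s\<bar> ^ CARD('n))"
    using lborel_affine[OF assms, of t] by simp
  show "integrable lborel (\<lambda>x. f (t + s *\<^sub>R x))" if f: "integrable lborel f"
  proof -
    have [measurable]: "f \<in> borel_measurable borel"
      using borel_measurable_integrable[OF f] by simp
    have "integrable lborel (\<lambda>x. \<bar>s\<bar> ^ CARD('n) *\<^sub>R f (t + s *\<^sub>R x))"
      using f by (subst (asm) A) (simp add: integrable_density integrable_distr_eq)
    then have "integrable lborel (\<lambda>x. (1 / \<bar>s\<bar> ^ CARD('n)) *\<^sub>R (\<bar>s\<bar> ^ CARD('n) *\<^sub>R f (t + s *\<^sub>R x)))"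
      by (rule integrable_scaleR_right)
    then show ?thesis using assms by simp
  qed
  show "(LINT x|lborel. f x) = \<bar>s\<bar> ^ CARD('n) *\<^sub>R (LINT x|lborel. f (t + s *\<^sub>R x))"
  proof (cases "f \<in> borel_measurable borel")
    case True
    then show ?thesis by (subst A) (simp add: integral_density integral_distr)
  next
    case False
    then have "\<not> integrable lborel f" "\<not> integrable lborel (\<lambda>x. f (t + s *\<^sub>R x))"
      using * borel_measurable_integrable[of lborel f] by auto
    then show ?thesis by (simp add: not_integrable_integral_eq)
  qed
qed

lemma nn_integral_translate:
  fixes f :: "real^'n \<Rightarrow> ennreal"
  assumes [measurable]: "f \<in> borel_measurable borel"
  shows "(\<integral>\<^sup>+x. f (x + t) \<partial>lborel) = (\<integral>\<^sup>+x. f x \<partial>lborel)"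
proof -
  have "(\<integral>\<^sup>+x. f x \<partial>lborel) = (\<integral>\<^sup>+x. f x \<partial>distr lborel borel ((+) t))"
    by (simp only: lborel_distr_plus)
  also have "\<dots> = (\<integral>\<^sup>+x. f (t + x) \<partial>lborel)"
    by (subst nn_integral_distr) simp_all
  finally show ?thesis by (simp add: add.commute)
qed

lemma integrable_mult_exp:
  fixes f :: "real^'n \<Rightarrow> complex"
  assumes "integrable lborel f"
  shows "integrable lborel (\<lambda>x. f x * exp (- \<i> * of_real (k \<bullet> x)))"
proof (rule Bochner_Integration.integrable_bound[OF assms])
  have [measurable]: "f \<in> borel_measurable borel"
    using borel_measurable_integrable[OF assms] by simp
  show "(\<lambda>x. f x * exp (- \<i> * of_real (k \<bullet> x))) \<in> borel_measurable lborel" by simp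
qed (simp add: norm_mult)

lemma measurable_fourier [measurable]:
  fixes f :: "real^'n \<Rightarrow> complex"
  assumes [measurable]: "f \<in> borel_measurable borel"
  shows "fourier f \<in> borel_measurable borel"
proof -
  have "(\<lambda>k. LINT x|lborel. f x * exp (- \<i> * of_real (k \<bullet> x))) \<in> borel_measurable (borel :: (real^'n) measure)"
    by (rule lborel.borel_measurable_lebesgue_integral) measurable
  then show ?thesis unfolding fourier_def[abs_def] by measurable
qed

lemma cmod_fourier_le:
  fixes f :: "real^'n \<Rightarrow> complex"
  shows "cmod (fourier f k) \<le> (2 * pi) powr (- real CARD('n) / 2) * (LINT x|lborel. cmod (f x))"
proof -
  have "cmod (LINT x|lborel. f x * exp (- \<i> * of_real (k \<bullet> x))) \<le> (LINT x|lborel. cmod (f x * exp (- \<i> * of_real (k \<bullet> x))))"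
    by (rule integral_norm_bound)
  then show ?thesis by (simp add: fourier_def norm_mult mult_left_mono)
qed

text \<open>
  Fubini's theorem applied to \<open>u(x) v(k) exp(- i k\<cdot>x)\<close>.
\<close>

lemma fourier_multiplication_formula:
  fixes u v :: "real^'n \<Rightarrow> complex"
  assumes u: "integrable lborel u" and v: "integrable lborel v"
  shows "(LINT k|lborel. fourier u k * v k) = (LINT x|lborel. u x * fourier v x)"
proof -
  have [measurable]: "u \<in> borel_measurable borel" "v \<in> borel_measurable borel"
    using borel_measurable_integrable[OF u] borel_measurable_integrable[OF v] by simp_all
  let ?E = "\<lambda>k x. exp (- \<i> * of_real (k \<bullet> x))"
  have int: "integrable (lborel \<Otimes>\<^sub>M lborel) (\<lambda>(k, x). u x * v k * ?E k x)"
  proof (rule lborel_pair.Fubini_integrable)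
    show "integrable lborel (\<lambda>k. LINT x|lborel. norm (case (k, x) of (k, x) \<Rightarrow> u x * v k * ?E k x))"
      using v by (simp add: norm_mult)
    show "AE k in lborel. integrable lborel (\<lambda>x. case (k, x) of (k, x) \<Rightarrow> u x * v k * ?E k x)"
      using integrable_mult_exp[OF u] by (auto intro!: AE_I2 simp: mult.assoc mult.left_commute[of _ "v _"])
  qed measurable
  let ?c = "complex_of_real ((2 * pi) powr (- real CARD('n) / 2))"
  have left: "fourier u k * v k = ?c * (LINT x|lborel. u x * v k * ?E k x)" for k
  proof -
    have "(LINT x|lborel. u x * v k * ?E k x) = (LINT x|lborel. v k * (u x * ?E k x))"
      by (intro Bochner_Integration.integral_cong refl) (simp only: ac_simps)
    then show ?thesis by (simp add: fourier_def)
  qed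
  have right: "u x * fourier v x = ?c * (LINT k|lborel. u x * v k * ?E k x)" for x
  proof -
    have "(LINT k|lborel. u x * v k * ?E k x) = (LINT k|lborel. u x * (v k * ?E x k))"
      by (intro Bochner_Integration.integral_cong refl) (simp only: ac_simps inner_commute)
    then show ?thesis by (simp add: fourier_def)
  qed
  have "(LINT k|lborel. LINT x|lborel. u x * v k * ?E k x) = (LINT x|lborel. LINT k|lborel. u x * v k * ?E k x)"
    by (rule lborel_pair.Fubini_integral[OF int, symmetric])
  then show ?thesis by (simp only: left right integral_mult_right_zero)
qed

lemma integrable_gauss_damping:
  assumes "s > 0"
  shows "integrable lborel (\<lambda>k::real^'n. exp (- (norm (s *\<^sub>R k))\<^sup>2 / 2))"
proof -
  let ?c = "(2 * pi) powr (- real CARD('n) / 2)"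
  have "integrable lborel (\<lambda>k::real^'n. complex_of_real (gauss k))"
    using gauss_integral(1) by (rule integrable_of_real)
  then have "integrable lborel (\<lambda>k::real^'n. complex_of_real (gauss (0 + s *\<^sub>R k)))"
    using assms by (intro lborel_integral_affine(2)) auto
  from integrable_Re[OF this] have "integrable lborel (\<lambda>k::real^'n. gauss (s *\<^sub>R k))"
    by simp
  then have "integrable lborel (\<lambda>k::real^'n. inverse ?c * gauss (s *\<^sub>R k))"
    by (rule integrable_mult_right)
  then show ?thesis by (simp add: gauss_def)
qed

text \<open>
  Fourier inversion before the damping is removed: for \<open>s \<rightarrow> 0\<close> the left-hand side becomes the
  inverse transform of \<open>f^\<close>, and the right-hand side averages \<open>f\<close> on the scale \<open>s\<close> around \<open>x\<close>.
  It is the multiplication formula for \<open>f\<close> and a modulated Gaussian, whose transform is a translated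
  Gaussian.
\<close>

lemma fourier_damped_inverse:
  fixes f :: "real^'n \<Rightarrow> complex"
  assumes f: "integrable lborel f" and s: "s > 0"
  shows "fourier (\<lambda>k. fourier f (- k) * of_real (exp (- (norm (s *\<^sub>R k))\<^sup>2 / 2))) x
    = (LINT z|lborel. f (x + s *\<^sub>R z) * of_real (gauss z))"
proof -
  let ?c = "(2 * pi) powr (- real CARD('n) / 2)"
  let ?e = "\<lambda>k::real^'n. complex_of_real (exp (- (norm (s *\<^sub>R k))\<^sup>2 / 2))"
  have inte: "integrable lborel ?e"
    using integrable_gauss_damping[OF s] by (rule integrable_of_real)
  define v where "v k = ?e k * exp (- \<i> * of_real ((- x) \<bullet> k))" for k
  have v: "integrable lborel v"
    unfolding v_def by (rule integrable_mult_exp[OF inte])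
  have fv: "fourier v y = of_real ((1 / s) ^ CARD('n) * exp (- (norm ((1 / s) *\<^sub>R (y - x)))\<^sup>2 / 2))" for y
  proof -
    let ?y = "(1 / s) *\<^sub>R (y - x)"
    have "(LINT k|lborel. v k * exp (- \<i> * of_real (y \<bullet> k))) = (LINT k|lborel. ?e k * exp (- \<i> * of_real ((y - x) \<bullet> k)))"
    proof (intro Bochner_Integration.integral_cong refl)
      fix k
      have "exp (- \<i> * of_real ((- x) \<bullet> k)) * exp (- \<i> * of_real (y \<bullet> k)) = exp (- \<i> * of_real ((y - x) \<bullet> k))"
        unfolding exp_add[symmetric] by (simp add: inner_diff_left algebra_simps)
      then show "v k * exp (- \<i> * of_real (y \<bullet> k)) = ?e k * exp (- \<i> * of_real ((y - x) \<bullet> k))"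
        by (simp only: v_def mult.assoc)
    qed
    also have "\<dots> = (1 / s) ^ CARD('n) *\<^sub>R (LINT w|lborel. complex_of_real (exp (- (norm w)\<^sup>2 / 2)) * exp (- \<i> * of_real (?y \<bullet> w)))"
      using s lborel_integral_affine(1)[of "1 / s" "\<lambda>k. ?e k * exp (- \<i> * of_real ((y - x) \<bullet> k))" 0] by simp
    finally have "fourier v y = (1 / s) ^ CARD('n) *\<^sub>R (of_real ?c *
        (LINT w|lborel. complex_of_real (exp (- (norm w)\<^sup>2 / 2)) * exp (- \<i> * of_real (?y \<bullet> w))))"
      by (simp add: fourier_def scaleR_conv_of_real)
    also have "of_real ?c * (LINT w|lborel. complex_of_real (exp (- (norm w)\<^sup>2 / 2)) * exp (- \<i> * of_real (?y \<bullet> w)))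
      = (LINT w|lborel. of_real (gauss w) * exp (- \<i> * of_real (?y \<bullet> w)))"
      by (simp add: gauss_def mult.assoc flip: integral_mult_right_zero)
    also have "\<dots> = of_real (exp (- (norm ?y)\<^sup>2 / 2))" by (rule gauss_char)
    finally show ?thesis by (simp add: scaleR_conv_of_real)
  qed
  have "fourier (\<lambda>k. fourier f (- k) * ?e k) x
      = of_real ?c * (LINT k|lborel. fourier f (- k) * ?e k * exp (- \<i> * of_real (x \<bullet> k)))"
    by (simp only: fourier_def[of "\<lambda>k. fourier f (- k) * ?e k"])
  also have "(LINT k|lborel. fourier f (- k) * ?e k * exp (- \<i> * of_real (x \<bullet> k))) = (LINT k|lborel. fourier f k * v k)"
    by (subst lborel_integral_affine(1)[of "-1" _ 0]) (simp_all add: v_def ac_simps)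
  also have "(LINT k|lborel. fourier f k * v k) = (LINT y|lborel. f y * fourier v y)"
    by (rule fourier_multiplication_formula[OF f v])
  also have "\<dots> = s ^ CARD('n) *\<^sub>R (LINT z|lborel. f (x + s *\<^sub>R z) * fourier v (x + s *\<^sub>R z))"
    using s by (subst lborel_integral_affine(1)[of s _ x]) simp_all
  also have "\<dots> = (LINT z|lborel. f (x + s *\<^sub>R z) * of_real (exp (- (norm z)\<^sup>2 / 2)))"
  proof -
    have fv': "fourier v (x + s *\<^sub>R z) = of_real ((1 / s) ^ CARD('n)) * of_real (exp (- (norm z)\<^sup>2 / 2))" for z
      using s by (simp add: fv)
    have "(LINT z|lborel. f (x + s *\<^sub>R z) * fourier v (x + s *\<^sub>R z))
      = of_real ((1 / s) ^ CARD('n)) * (LINT z|lborel. f (x + s *\<^sub>R z) * of_real (exp (- (norm z)\<^sup>2 / 2)))"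
      by (simp only: fv' mult.left_commute[of _ "of_real ((1 / s) ^ CARD('n))"] integral_mult_right_zero)
    then show ?thesis using s by (simp add: scaleR_conv_of_real power_one_over)
  qed
  also have "of_real ?c * \<dots> = (LINT z|lborel. f (x + s *\<^sub>R z) * of_real (gauss z))"
    by (simp add: gauss_def ac_simps flip: integral_mult_right_zero)
  finally show ?thesis .
qed

section \<open>Bessel's inequality\<close>

lemma pred_cball [measurable]: "Measurable.pred borel (\<lambda>x::'a::real_normed_vector. x \<in> cball a R)"
  by (simp add: pred_def del: mem_cball)

text \<open>
  Fatou's lemma in the form in which it passes bounds on \<open>L\<^sup>2\<close> distances to pointwise limits.
\<close>

lemma nn_integral_lim_le:
  fixes u :: "nat \<Rightarrow> 'a \<Rightarrow> ennreal"
  assumes [measurable]: "\<And>n. u n \<in> borel_measurable M"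
    and lim: "AE x in M. (\<lambda>n. u n x) \<longlonglongrightarrow> w x"
    and le: "\<And>n. (\<integral>\<^sup>+x. u n x \<partial>M) \<le> B n" and B: "B \<longlonglongrightarrow> b"
  shows "(\<integral>\<^sup>+x. w x \<partial>M) \<le> b"
proof -
  have "(\<integral>\<^sup>+x. w x \<partial>M) = (\<integral>\<^sup>+x. liminf (\<lambda>n. u n x) \<partial>M)"
  proof (rule nn_integral_cong_AE)
    show "AE x in M. w x = liminf (\<lambda>n. u n x)"
      using lim by eventually_elim (simp add: lim_imp_Liminf)
  qed
  also have "\<dots> \<le> liminf (\<lambda>n. \<integral>\<^sup>+x. u n x \<partial>M)"
    by (rule nn_integral_liminf) simp
  also have "\<dots> \<le> liminf B"
    using le by (intro Liminf_mono) auto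
  also have "\<dots> = b" using B by (simp add: lim_imp_Liminf)
  finally show ?thesis .
qed

lemma norm_integral_le_nn_integral: "ennreal (norm (integral\<^sup>L M f)) \<le> (\<integral>\<^sup>+x. ennreal (norm (f x)) \<partial>M)"
  by (cases "integrable M f") (simp_all add: integral_norm_bound_ennreal not_integrable_integral_eq)

lemma cmod_add_square_le:
  "ennreal ((cmod (x + y))\<^sup>2) \<le> 2 * ennreal ((cmod x)\<^sup>2) + 2 * ennreal ((cmod y)\<^sup>2)"
proof -
  have "(cmod (x + y))\<^sup>2 \<le> (cmod x + cmod y)\<^sup>2"
    by (intro power_mono norm_triangle_ineq) simp
  also have "\<dots> \<le> 2 * (cmod x)\<^sup>2 + 2 * (cmod y)\<^sup>2"
    using sum_squares_bound[of "cmod x" "cmod y"] by (simp add: power2_sum)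
  finally have "ennreal ((cmod (x + y))\<^sup>2) \<le> ennreal (2 * (cmod x)\<^sup>2 + 2 * (cmod y)\<^sup>2)"
    by (rule ennreal_leI)
  then show ?thesis by (simp add: ennreal_plus ennreal_mult)
qed

lemma nn_integral_square_add_le:
  assumes [measurable]: "f \<in> borel_measurable M" "g \<in> borel_measurable M"
  shows "(\<integral>\<^sup>+x. ennreal ((cmod (f x + g x))\<^sup>2) \<partial>M)
    \<le> 2 * (\<integral>\<^sup>+x. ennreal ((cmod (f x))\<^sup>2) \<partial>M) + 2 * (\<integral>\<^sup>+x. ennreal ((cmod (g x))\<^sup>2) \<partial>M)"
proof -
  have "(\<integral>\<^sup>+x. ennreal ((cmod (f x + g x))\<^sup>2) \<partial>M)
      \<le> (\<integral>\<^sup>+x. 2 * ennreal ((cmod (f x))\<^sup>2) + 2 * ennreal ((cmod (g x))\<^sup>2) \<partial>M)"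
    by (intro nn_integral_mono cmod_add_square_le)
  also have "\<dots> = 2 * (\<integral>\<^sup>+x. ennreal ((cmod (f x))\<^sup>2) \<partial>M) + 2 * (\<integral>\<^sup>+x. ennreal ((cmod (g x))\<^sup>2) \<partial>M)"
    by (simp add: nn_integral_add nn_integral_cmult)
  finally show ?thesis .
qed

lemma L2_iff_nn_integral:
  "f \<in> L2 \<longleftrightarrow> f \<in> borel_measurable borel \<and> (\<integral>\<^sup>+x. ennreal ((cmod (f x))\<^sup>2) \<partial>lborel) < \<infinity>"
  by (auto simp: L2_def integrable_iff_bounded)

lemma cnj_fourier: "cnj (fourier f k) = fourier (\<lambda>x. cnj (f x)) (- k)"
proof -
  have "cnj (LINT x|lborel. f x * exp (- \<i> * of_real (k \<bullet> x)))
      = (LINT x|lborel. cnj (f x * exp (- \<i> * of_real (k \<bullet> x))))"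
    by (rule Bochner_Integration.integral_cnj[symmetric])
  then show ?thesis by (simp add: fourier_def exp_cnj)
qed

text \<open>
  Pointwise, \<open>|f(x)| |f(x + s z)| \<le> (|f(x)|\<^sup>2 + |f(x + s z)|\<^sup>2) / 2\<close>. Integrated against the
  probability density in \<open>z\<close>, either term contributes half of \<open>\<integral> |f|\<^sup>2\<close>, the second one by
  translation invariance.
\<close>

lemma gauss_average_square_le:
  fixes f :: "real^'n \<Rightarrow> complex"
  assumes [measurable]: "f \<in> borel_measurable borel"
  shows "(\<integral>\<^sup>+x. ennreal (cmod (f x * (LINT z|lborel. cnj (f (x + s *\<^sub>R z)) * of_real (gauss z)))) \<partial>lborel)
    \<le> (\<integral>\<^sup>+x. ennreal ((cmod (f x))\<^sup>2) \<partial>lborel)"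
proof -
  let ?I = "\<integral>\<^sup>+x. ennreal ((cmod (f x))\<^sup>2) \<partial>lborel"
  have [measurable]: "(gauss :: real^'n \<Rightarrow> real) \<in> borel_measurable borel"
    unfolding gauss_def[abs_def] by measurable
  have gauss1: "(\<integral>\<^sup>+z. ennreal (gauss (z::real^'n)) \<partial>lborel) = 1"
    using nn_integral_eq_integral[OF gauss_integral(1)[where 'n='n]] gauss_integral(2)[where 'n='n] by (simp add: gauss_nonneg)
  have pt: "ennreal (cmod (f x * (LINT z|lborel. cnj (f (x + s *\<^sub>R z)) * of_real (gauss z))))
    \<le> (\<integral>\<^sup>+z. ennreal (1/2) * (ennreal ((cmod (f x))\<^sup>2) * ennreal (gauss z) + ennreal ((cmod (f (x + s *\<^sub>R z)))\<^sup>2) * ennreal (gauss z)) \<partial>lborel)" for x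
  proof -
    have "ennreal (cmod (f x * (LINT z|lborel. cnj (f (x + s *\<^sub>R z)) * of_real (gauss z))))
      = ennreal (cmod (LINT z|lborel. f x * (cnj (f (x + s *\<^sub>R z)) * of_real (gauss z))))"
      by simp
    also have "\<dots> \<le> (\<integral>\<^sup>+z. ennreal (cmod (f x * (cnj (f (x + s *\<^sub>R z)) * of_real (gauss z)))) \<partial>lborel)"
      by (rule norm_integral_le_nn_integral)
    also have "\<dots> \<le> (\<integral>\<^sup>+z. ennreal (1/2) * (ennreal ((cmod (f x))\<^sup>2) * ennreal (gauss z) + ennreal ((cmod (f (x + s *\<^sub>R z)))\<^sup>2) * ennreal (gauss z)) \<partial>lborel)"
    proof (rule nn_integral_mono)
      fix z :: "real^'n"
      have "cmod (f x) * cmod (f (x + s *\<^sub>R z)) * gauss z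
        \<le> (1/2 * ((cmod (f x))\<^sup>2 + (cmod (f (x + s *\<^sub>R z)))\<^sup>2)) * gauss z"
        using sum_squares_bound[of "cmod (f x)" "cmod (f (x + s *\<^sub>R z))"] gauss_nonneg
        by (intro mult_right_mono) auto
      then have "ennreal (cmod (f x * (cnj (f (x + s *\<^sub>R z)) * of_real (gauss z))))
        \<le> ennreal (1/2 * ((cmod (f x))\<^sup>2 * gauss z + (cmod (f (x + s *\<^sub>R z)))\<^sup>2 * gauss z))"
        using gauss_nonneg[of z] by (intro ennreal_leI) (simp add: norm_mult algebra_simps)
      then show "ennreal (cmod (f x * (cnj (f (x + s *\<^sub>R z)) * of_real (gauss z))))
        \<le> ennreal (1/2) * (ennreal ((cmod (f x))\<^sup>2) * ennreal (gauss z) + ennreal ((cmod (f (x + s *\<^sub>R z)))\<^sup>2) * ennreal (gauss z))"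
        by (simp only: ennreal_mult ennreal_plus gauss_nonneg zero_le_power2 mult_nonneg_nonneg add_nonneg_nonneg zero_le_divide_1_iff zero_le_numeral)
    qed
    finally show ?thesis .
  qed
  have "(\<integral>\<^sup>+x. ennreal (cmod (f x * (LINT z|lborel. cnj (f (x + s *\<^sub>R z)) * of_real (gauss z)))) \<partial>lborel)
    \<le> (\<integral>\<^sup>+x. \<integral>\<^sup>+z. ennreal (1/2) * (ennreal ((cmod (f x))\<^sup>2) * ennreal (gauss z) + ennreal ((cmod (f (x + s *\<^sub>R z)))\<^sup>2) * ennreal (gauss z)) \<partial>lborel \<partial>lborel)"
    by (intro nn_integral_mono pt)
  also have "\<dots> = ennreal (1/2) * ((\<integral>\<^sup>+x. \<integral>\<^sup>+z. ennreal ((cmod (f x))\<^sup>2) * ennreal (gauss (z::real^'n)) \<partial>lborel \<partial>lborel)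
      + (\<integral>\<^sup>+x. \<integral>\<^sup>+z. ennreal ((cmod (f (x + s *\<^sub>R z)))\<^sup>2) * ennreal (gauss z) \<partial>lborel \<partial>lborel))"
    by (simp add: nn_integral_add nn_integral_cmult)
  also have "(\<integral>\<^sup>+x. \<integral>\<^sup>+z. ennreal ((cmod (f x))\<^sup>2) * ennreal (gauss (z::real^'n)) \<partial>lborel \<partial>lborel) = ?I"
    by (simp add: nn_integral_cmult gauss1)
  also have "(\<integral>\<^sup>+x. \<integral>\<^sup>+z. ennreal ((cmod (f (x + s *\<^sub>R z)))\<^sup>2) * ennreal (gauss z) \<partial>lborel \<partial>lborel)
    = (\<integral>\<^sup>+z. \<integral>\<^sup>+x. ennreal ((cmod (f (x + s *\<^sub>R z)))\<^sup>2) * ennreal (gauss z) \<partial>lborel \<partial>lborel)"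
    by (rule lborel_pair.Fubini'[symmetric]) measurable
  also have "\<dots> = (\<integral>\<^sup>+z. ?I * ennreal (gauss (z::real^'n)) \<partial>lborel)"
    using nn_integral_translate[of "\<lambda>x. ennreal ((cmod (f x))\<^sup>2)"] by (simp add: nn_integral_multc)
  also have "\<dots> = ?I" by (simp add: nn_integral_cmult gauss1)
  also have "ennreal (1/2) * (?I + ?I) = ?I"
  proof -
    have "ennreal (1/2) * (?I + ?I) = (ennreal (1/2) + ennreal (1/2)) * ?I" by (simp add: algebra_simps)
    also have "ennreal (1/2) + ennreal (1/2) = 1" by (subst ennreal_plus[symmetric]) simp_all
    finally show ?thesis by simp
  qed
  finally show ?thesis .
qed

text \<open>
  The damped integral \<open>\<integral> |f^|\<^sup>2 exp(- |s k|\<^sup>2 / 2) dk\<close> is, by the multiplication formula and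
  \<open>fourier_damped_inverse\<close>, the integral of \<open>f\<close> against a Gaussian average of its conjugate, and
  \<open>gauss_average_square_le\<close> bounds it uniformly in \<open>s\<close>. Fatou's lemma removes the damping.
\<close>

lemma fourier_Bessel:
  fixes f :: "real^'n \<Rightarrow> complex"
  assumes f: "integrable lborel f"
  shows "(\<integral>\<^sup>+k. ennreal ((cmod (fourier f k))\<^sup>2) \<partial>lborel) \<le> (\<integral>\<^sup>+x. ennreal ((cmod (f x))\<^sup>2) \<partial>lborel)"
proof -
  have [measurable]: "f \<in> borel_measurable borel"
    using borel_measurable_integrable[OF f] by simp
  let ?e = "\<lambda>s (k::real^'n). exp (- (norm (s *\<^sub>R k))\<^sup>2 / 2)"
  define B where "B = (2 * pi) powr (- real CARD('n) / 2) * (LINT x|lborel. cmod (f x))"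
  have B: "cmod (fourier f k) \<le> B" for k unfolding B_def by (rule cmod_fourier_le)
  have damped: "(\<integral>\<^sup>+k. ennreal ((cmod (fourier f k))\<^sup>2 * ?e s k) \<partial>lborel) \<le> (\<integral>\<^sup>+x. ennreal ((cmod (f x))\<^sup>2) \<partial>lborel)"
    if s: "s > 0" for s
  proof -
    define v where "v k = cnj (fourier f k) * of_real (?e s k)" for k
    have v: "integrable lborel v" unfolding v_def
    proof (rule Bochner_Integration.integrable_bound[OF integrable_mult_right[OF integrable_gauss_damping[OF s], of B]])
      show "AE k in lborel. norm (cnj (fourier f k) * of_real (?e s k)) \<le> norm (B * ?e s k)"
        using B by (auto intro!: AE_I2 mult_mono simp: norm_mult abs_mult intro: order_trans[OF _ abs_ge_self])
    qed measurable
    have int: "integrable lborel (\<lambda>k. (cmod (fourier f k))\<^sup>2 * ?e s k)"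
    proof (rule Bochner_Integration.integrable_bound[OF integrable_mult_right[OF integrable_gauss_damping[OF s], of "B\<^sup>2"]])
      show "AE k in lborel. norm ((cmod (fourier f k))\<^sup>2 * ?e s k) \<le> norm (B\<^sup>2 * ?e s k)"
        using B by (auto intro!: AE_I2 mult_mono power_mono simp: abs_mult)
    qed measurable
    have fv: "fourier v x = (LINT z|lborel. cnj (f (x + s *\<^sub>R z)) * of_real (gauss z))" for x
      unfolding v_def cnj_fourier
      using fourier_damped_inverse[of "\<lambda>x. cnj (f x)" s x] f s by simp
    have "(\<integral>\<^sup>+k. ennreal ((cmod (fourier f k))\<^sup>2 * ?e s k) \<partial>lborel) = ennreal (LINT k|lborel. (cmod (fourier f k))\<^sup>2 * ?e s k)"
      by (rule nn_integral_eq_integral[OF int]) simp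
    also have "(LINT k|lborel. (cmod (fourier f k))\<^sup>2 * ?e s k) = cmod (of_real (LINT k|lborel. (cmod (fourier f k))\<^sup>2 * ?e s k))"
      by (simp add: integral_nonneg_AE)
    also have "complex_of_real (LINT k|lborel. (cmod (fourier f k))\<^sup>2 * ?e s k) = (LINT k|lborel. fourier f k * v k)"
      unfolding v_def by (subst integral_complex_of_real[symmetric])
        (simp only: of_real_mult complex_norm_square mult.assoc)
    also have "\<dots> = (LINT x|lborel. f x * fourier v x)"
      by (rule fourier_multiplication_formula[OF f v])
    also have "ennreal (cmod \<dots>) \<le> (\<integral>\<^sup>+x. ennreal (cmod (f x * fourier v x)) \<partial>lborel)"
      by (rule norm_integral_le_nn_integral)
    also have "\<dots> \<le> (\<integral>\<^sup>+x. ennreal ((cmod (f x))\<^sup>2) \<partial>lborel)"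
      unfolding fv by (rule gauss_average_square_le) simp
    finally show ?thesis .
  qed
  show ?thesis
  proof (rule nn_integral_lim_le)
    let ?s = "\<lambda>n. inverse (real (Suc n))"
    show "(\<lambda>k. ennreal ((cmod (fourier f k))\<^sup>2 * ?e (?s n) k)) \<in> borel_measurable lborel" for n
      by measurable
    show "(\<integral>\<^sup>+k. ennreal ((cmod (fourier f k))\<^sup>2 * ?e (?s n) k) \<partial>lborel) \<le> (\<integral>\<^sup>+x. ennreal ((cmod (f x))\<^sup>2) \<partial>lborel)" for n
      by (rule damped) simp
    have "(\<lambda>n. ennreal ((cmod (fourier f k))\<^sup>2 * ?e (?s n) k)) \<longlonglongrightarrow> ennreal ((cmod (fourier f k))\<^sup>2 * ?e 0 k)" for k
      by (intro tendsto_intros LIMSEQ_inverse_real_of_nat) simp_all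
    then show "AE k in lborel. (\<lambda>n. ennreal ((cmod (fourier f k))\<^sup>2 * ?e (?s n) k)) \<longlonglongrightarrow> ennreal ((cmod (fourier f k))\<^sup>2)"
      by simp
  qed simp
qed

section \<open>The Fourier transform of square integrable functions\<close>

lemma fourier_diff:
  fixes f g :: "real^'n \<Rightarrow> complex"
  assumes "integrable lborel f" "integrable lborel g"
  shows "fourier (\<lambda>x. f x - g x) k = fourier f k - fourier g k"
  unfolding fourier_def left_diff_distrib
  by (subst Bochner_Integration.integral_diff)
    (auto intro: integrable_mult_exp assms simp only: right_diff_distrib)

lemma fourier_trunc_eq_fourier: "fourier_trunc f R = fourier (\<lambda>x. indicator (cball 0 R) x *\<^sub>R f x)"
  by (simp add: fun_eq_iff fourier_trunc_def fourier_def set_lebesgue_integral_def)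

lemma L2_truncation_integrable:
  fixes f :: "real^'n \<Rightarrow> complex"
  assumes f: "f \<in> L2"
  shows "integrable lborel (\<lambda>x. indicator (cball 0 R) x *\<^sub>R f x)"
proof (rule Bochner_Integration.integrable_bound)
  have [measurable]: "f \<in> borel_measurable borel" using f by (rule L2_measurable)
  show "integrable lborel (\<lambda>x. indicator (cball 0 R) x + (cmod (f x))\<^sup>2)"
    using emeasure_lborel_cball_finite[of "0::real^'n" R]
    by (intro Bochner_Integration.integrable_add L2_integrable_square[OF f] integrable_real_indicator) auto
  have "cmod (f x) \<le> 1 + (cmod (f x))\<^sup>2" for x
    using sum_squares_bound[of 1 "cmod (f x)"] norm_ge_zero[of "f x"] by (simp del: norm_ge_zero)
  then show "AE x in lborel. norm (indicator (cball 0 R) x *\<^sub>R f x) \<le> norm (indicator (cball 0 R) x + (cmod (f x))\<^sup>2)"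
    by (auto simp: indicator_def)
  show "(\<lambda>x. indicator (cball 0 R) x *\<^sub>R f x) \<in> borel_measurable lborel" by measurable
qed

lemma L2_truncation_tendsto:
  fixes f :: "real^'n \<Rightarrow> complex"
  assumes f: "f \<in> L2"
  shows "((\<lambda>R. \<integral>\<^sup>+x. ennreal ((cmod (indicator (cball 0 R) x *\<^sub>R f x - f x))\<^sup>2) \<partial>lborel) \<longlongrightarrow> 0) at_top"
proof (rule tendsto_at_topI_sequentially)
  fix X :: "nat \<Rightarrow> real" assume X: "filterlim X at_top sequentially"
  have [measurable]: "f \<in> borel_measurable borel" using f by (rule L2_measurable)
  have "(\<lambda>n. \<integral>\<^sup>+x. ennreal ((cmod (indicator (cball 0 (X n)) x *\<^sub>R f x - f x))\<^sup>2) \<partial>lborel) \<longlonglongrightarrow> (\<integral>\<^sup>+(x::real^'n). 0 \<partial>lborel)"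
  proof (rule nn_integral_dominated_convergence[where w="\<lambda>x. ennreal ((cmod (f x))\<^sup>2)"])
    show "(\<integral>\<^sup>+x. ennreal ((cmod (f x))\<^sup>2) \<partial>lborel) < \<infinity>"
      using f by (simp add: L2_iff_nn_integral)
    show "AE x in lborel. (\<lambda>n. ennreal ((cmod (indicator (cball 0 (X n)) x *\<^sub>R f x - f x))\<^sup>2)) \<longlonglongrightarrow> 0"
    proof (rule AE_I2, rule tendsto_eventually)
      fix x :: "real^'n"
      have "eventually (\<lambda>n. norm x \<le> X n) sequentially"
        using X by (simp add: filterlim_at_top)
      then show "eventually (\<lambda>n. ennreal ((cmod (indicator (cball 0 (X n)) x *\<^sub>R f x - f x))\<^sup>2) = 0) sequentially"
        by eventually_elim simp
    qed
  qed (auto simp: indicator_def intro!: AE_I2)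
  then show "(\<lambda>n. \<integral>\<^sup>+x. ennreal ((cmod (indicator (cball 0 (X n)) x *\<^sub>R f x - f x))\<^sup>2) \<partial>lborel) \<longlonglongrightarrow> 0"
    by simp
qed

text \<open>
  The detour over \<open>h\<close> keeps the right-hand side free of differences of approximants: below, \<open>f\<close>
  and \<open>g\<close> are integrable approximations of the square integrable function \<open>h\<close>.
\<close>

lemma fourier_Bessel_diff:
  fixes f g :: "real^'n \<Rightarrow> complex"
  assumes f: "integrable lborel f" and g: "integrable lborel g" and h: "h \<in> borel_measurable borel"
  shows "(\<integral>\<^sup>+k. ennreal ((cmod (fourier f k - fourier g k))\<^sup>2) \<partial>lborel)
    \<le> 2 * (\<integral>\<^sup>+x. ennreal ((cmod (f x - h x))\<^sup>2) \<partial>lborel) + 2 * (\<integral>\<^sup>+x. ennreal ((cmod (g x - h x))\<^sup>2) \<partial>lborel)"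
proof -
  have [measurable]: "f \<in> borel_measurable borel" "g \<in> borel_measurable borel" "h \<in> borel_measurable borel"
    using borel_measurable_integrable[OF f] borel_measurable_integrable[OF g] h by simp_all
  have "(\<integral>\<^sup>+k. ennreal ((cmod (fourier f k - fourier g k))\<^sup>2) \<partial>lborel)
      \<le> (\<integral>\<^sup>+x. ennreal ((cmod (f x - g x))\<^sup>2) \<partial>lborel)"
    using fourier_Bessel[of "\<lambda>x. f x - g x"] f g by (simp add: fourier_diff)
  also have "\<dots> = (\<integral>\<^sup>+x. ennreal ((cmod ((f x - h x) + (h x - g x)))\<^sup>2) \<partial>lborel)"
    by simp
  also have "\<dots> \<le> 2 * (\<integral>\<^sup>+x. ennreal ((cmod (f x - h x))\<^sup>2) \<partial>lborel) + 2 * (\<integral>\<^sup>+x. ennreal ((cmod (h x - g x))\<^sup>2) \<partial>lborel)"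
    by (rule nn_integral_square_add_le) measurable
  finally show ?thesis by (simp add: norm_minus_commute[of "h _" "g _"])
qed

text \<open>
  The truncations to balls in the definition of the transform can be replaced by any integrable
  \<open>L\<^sup>2\<close> approximation \<open>g\<^sub>n\<close> of \<open>f\<close> for which the transforms converge almost everywhere. By Bessel's
  inequality and Fatou's lemma, the distance of \<open>F\<close> to the transform of a truncation is bounded by
  that of the truncation to \<open>f\<close>. The lemma is used twice: for existence with truncations as \<open>g\<^sub>n\<close>,
  and for inversion with Gaussian damping.
\<close>

lemma is_L2_fourier_limit:
  fixes f F :: "real^'n \<Rightarrow> complex"
  assumes f: "f \<in> L2" and g: "\<And>n. integrable lborel (g n)"
    and conv: "(\<lambda>n. \<integral>\<^sup>+x. ennreal ((cmod (g n x - f x))\<^sup>2) \<partial>lborel) \<longlonglongrightarrow> 0"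
    and F: "F \<in> borel_measurable borel"
    and lim: "AE k in lborel. (\<lambda>n. fourier (g n) k) \<longlonglongrightarrow> F k"
  shows "is_L2_fourier f F"
proof -
  have [measurable]: "f \<in> borel_measurable borel" "F \<in> borel_measurable borel"
    "g n \<in> borel_measurable borel" for n
    using L2_measurable[OF f] F borel_measurable_integrable[OF g] by simp_all
  let ?t = "\<lambda>R x. indicator (cball 0 R) x *\<^sub>R f x"
  let ?\<epsilon> = "\<lambda>n. \<integral>\<^sup>+x. ennreal ((cmod (g n x - f x))\<^sup>2) \<partial>lborel"
  let ?\<tau> = "\<lambda>R. \<integral>\<^sup>+x. ennreal ((cmod (?t R x - f x))\<^sup>2) \<partial>lborel"
  have near: "(\<integral>\<^sup>+k. ennreal ((cmod (fourier_trunc f R k - F k))\<^sup>2) \<partial>lborel) \<le> 2 * ?\<tau> R" for R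
  proof (rule nn_integral_lim_le)
    show "(\<integral>\<^sup>+k. ennreal ((cmod (fourier_trunc f R k - fourier (g n) k))\<^sup>2) \<partial>lborel) \<le> 2 * ?\<tau> R + 2 * ?\<epsilon> n" for n
      unfolding fourier_trunc_eq_fourier
      by (rule fourier_Bessel_diff) (auto intro: L2_truncation_integrable f g)
    show "AE k in lborel. (\<lambda>n. ennreal ((cmod (fourier_trunc f R k - fourier (g n) k))\<^sup>2))
        \<longlonglongrightarrow> ennreal ((cmod (fourier_trunc f R k - F k))\<^sup>2)"
      using lim by eventually_elim (intro tendsto_intros)
    have "(\<lambda>n. 2 * ?\<tau> R + 2 * ?\<epsilon> n) \<longlonglongrightarrow> 2 * ?\<tau> R + 2 * 0"
      by (intro tendsto_intros conv ennreal_tendsto_cmult) auto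
    then show "(\<lambda>n. 2 * ?\<tau> R + 2 * ?\<epsilon> n) \<longlonglongrightarrow> 2 * ?\<tau> R" by simp
    show "(\<lambda>k. ennreal ((cmod (fourier_trunc f R k - fourier (g n) k))\<^sup>2)) \<in> borel_measurable lborel" for n
      unfolding fourier_trunc_eq_fourier by measurable
  qed
  have "(\<integral>\<^sup>+k. ennreal ((cmod (F k))\<^sup>2) \<partial>lborel) \<le> 2 * (\<integral>\<^sup>+x. ennreal ((cmod (f x))\<^sup>2) \<partial>lborel)"
  proof (rule nn_integral_lim_le)
    show "(\<integral>\<^sup>+k. ennreal ((cmod (fourier (g n) k))\<^sup>2) \<partial>lborel)
        \<le> 2 * (\<integral>\<^sup>+x. ennreal ((cmod (f x))\<^sup>2) \<partial>lborel) + 2 * ?\<epsilon> n" for n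
    proof -
      have "(\<integral>\<^sup>+k. ennreal ((cmod (fourier (g n) k))\<^sup>2) \<partial>lborel) \<le> (\<integral>\<^sup>+x. ennreal ((cmod (f x + (g n x - f x)))\<^sup>2) \<partial>lborel)"
        using fourier_Bessel[OF g] by simp
      also have "\<dots> \<le> 2 * (\<integral>\<^sup>+x. ennreal ((cmod (f x))\<^sup>2) \<partial>lborel) + 2 * ?\<epsilon> n"
        by (rule nn_integral_square_add_le) measurable
      finally show ?thesis .
    qed
    show "AE k in lborel. (\<lambda>n. ennreal ((cmod (fourier (g n) k))\<^sup>2)) \<longlonglongrightarrow> ennreal ((cmod (F k))\<^sup>2)"
      using lim by eventually_elim (intro tendsto_intros)
    have "(\<lambda>n. 2 * (\<integral>\<^sup>+x. ennreal ((cmod (f x))\<^sup>2) \<partial>lborel) + 2 * ?\<epsilon> n)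
        \<longlonglongrightarrow> 2 * (\<integral>\<^sup>+x. ennreal ((cmod (f x))\<^sup>2) \<partial>lborel) + 2 * 0"
      by (intro tendsto_intros conv ennreal_tendsto_cmult) auto
    then show "(\<lambda>n. 2 * (\<integral>\<^sup>+x. ennreal ((cmod (f x))\<^sup>2) \<partial>lborel) + 2 * ?\<epsilon> n)
        \<longlonglongrightarrow> 2 * (\<integral>\<^sup>+x. ennreal ((cmod (f x))\<^sup>2) \<partial>lborel)" by simp
  qed measurable
  also have "\<dots> < \<infinity>" using f by (simp add: L2_iff_nn_integral ennreal_mult_less_top)
  finally have "F \<in> L2" by (simp add: L2_iff_nn_integral)
  moreover have "((\<lambda>R. \<integral>\<^sup>+k. ennreal ((cmod (fourier_trunc f R k - F k))\<^sup>2) \<partial>lborel) \<longlongrightarrow> 0) at_top"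
  proof (rule tendsto_sandwich[OF _ _ tendsto_const])
    have "((\<lambda>R. 2 * ?\<tau> R) \<longlongrightarrow> 2 * 0) at_top"
      by (intro ennreal_tendsto_cmult L2_truncation_tendsto[OF f]) simp
    then show "((\<lambda>R. 2 * ?\<tau> R) \<longlongrightarrow> 0) at_top" by simp
  qed (use near in auto)
  ultimately show ?thesis by (simp add: is_L2_fourier_def)
qed

lemma is_L2_fourier_unique:
  fixes f F G :: "real^'n \<Rightarrow> complex"
  assumes f: "f \<in> L2" and F: "is_L2_fourier f F" and G: "is_L2_fourier f G"
  shows "AE k in lborel. F k = G k"
proof -
  have [measurable]: "f \<in> borel_measurable borel" "F \<in> borel_measurable borel" "G \<in> borel_measurable borel"
    using f F G by (auto simp: is_L2_fourier_def L2_measurable)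
  let ?d = "\<lambda>F R. \<integral>\<^sup>+k. ennreal ((cmod (fourier_trunc f R k - F k))\<^sup>2) \<partial>lborel"
  have [measurable]: "fourier_trunc f R \<in> borel_measurable borel" for R
    unfolding fourier_trunc_eq_fourier by measurable
  have le: "(\<integral>\<^sup>+k. ennreal ((cmod (F k - G k))\<^sup>2) \<partial>lborel) \<le> 2 * ?d F R + 2 * ?d G R" for R
  proof -
    have "(\<integral>\<^sup>+k. ennreal ((cmod (F k - G k))\<^sup>2) \<partial>lborel)
      = (\<integral>\<^sup>+k. ennreal ((cmod ((F k - fourier_trunc f R k) + (fourier_trunc f R k - G k)))\<^sup>2) \<partial>lborel)"
      by simp
    also have "\<dots> \<le> 2 * (\<integral>\<^sup>+k. ennreal ((cmod (F k - fourier_trunc f R k))\<^sup>2) \<partial>lborel) + 2 * ?d G R"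
      by (rule nn_integral_square_add_le) measurable
    finally show ?thesis by (simp add: norm_minus_commute[of "F _"])
  qed
  have "((\<lambda>R. 2 * ?d F R + 2 * ?d G R) \<longlongrightarrow> 2 * 0 + 2 * 0) at_top"
    using F G by (intro tendsto_intros ennreal_tendsto_cmult) (auto simp: is_L2_fourier_def)
  then have "(\<integral>\<^sup>+k. ennreal ((cmod (F k - G k))\<^sup>2) \<partial>lborel) \<le> 2 * 0 + 2 * 0"
    by (rule tendsto_lowerbound) (use le in auto)
  then have "(\<integral>\<^sup>+k. ennreal ((cmod (F k - G k))\<^sup>2) \<partial>lborel) = 0" by simp
  then have "AE k in lborel. ennreal ((cmod (F k - G k))\<^sup>2) = 0"
    by (subst (asm) nn_integral_0_iff_AE) measurable
  then show ?thesis by eventually_elim simp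
qed

text \<open>
  The Riesz-Fischer argument: along radii for which the truncation errors decay geometrically, the
  differences of successive transforms are summable at almost every point, so that the transforms
  converge almost everywhere.
\<close>

lemma is_L2_fourier_ex:
  fixes f :: "real^'n \<Rightarrow> complex"
  assumes f: "f \<in> L2"
  shows "\<exists>F. is_L2_fourier f F"
proof -
  have [measurable]: "f \<in> borel_measurable borel" using f by (rule L2_measurable)
  let ?t = "\<lambda>R x. indicator (cball 0 R) x *\<^sub>R f x"
  let ?\<tau> = "\<lambda>R. \<integral>\<^sup>+x. ennreal ((cmod (?t R x - f x))\<^sup>2) \<partial>lborel"
  have ex: "\<exists>R. ?\<tau> R < ennreal ((1/16)^n)" for n
  proof -
    have "eventually (\<lambda>R. ?\<tau> R < ennreal ((1/16)^n)) at_top"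
      by (rule order_tendstoD(2)[OF L2_truncation_tendsto[OF f]]) simp
    then show ?thesis by (rule eventually_happens'[rotated]) simp
  qed
  define R where "R n = (SOME R. ?\<tau> R < ennreal ((1/16)^n))" for n :: nat
  have R: "?\<tau> (R n) < ennreal ((1/16)^n)" for n
    unfolding R_def by (rule someI_ex[OF ex])
  define g where "g n = ?t (R n)" for n :: nat
  have g: "integrable lborel (g n)" for n
    unfolding g_def by (rule L2_truncation_integrable[OF f])
  have [measurable]: "g n \<in> borel_measurable borel" for n
    using borel_measurable_integrable[OF g] by simp
  have \<tau>: "(\<integral>\<^sup>+x. ennreal ((cmod (g n x - f x))\<^sup>2) \<partial>lborel) \<le> ennreal ((1/16)^n)" for n
    using R[of n] unfolding g_def by simp
  have conv: "(\<lambda>n. \<integral>\<^sup>+x. ennreal ((cmod (g n x - f x))\<^sup>2) \<partial>lborel) \<longlonglongrightarrow> 0"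
  proof (rule tendsto_sandwich[OF _ _ tendsto_const])
    have "(\<lambda>n. ennreal ((1/16)^n)) \<longlonglongrightarrow> ennreal 0"
      by (intro tendsto_ennrealI LIMSEQ_power_zero) simp
    then show "(\<lambda>n. ennreal ((1/16)^n)) \<longlonglongrightarrow> 0" by simp
  qed (use \<tau> in auto)
  \<comment> \<open>\<open>\<Sum> 4\<^sup>n |d\<^sub>n|\<^sup>2\<close> has a finite integral, hence \<open>|d\<^sub>n| \<le> const \<cdot> 2\<^sup>-\<^sup>n\<close> almost everywhere.\<close>
  define d where "d n k = fourier (g (Suc n)) k - fourier (g n) k" for n k
  have [measurable]: "d n \<in> borel_measurable borel" for n
    unfolding d_def[abs_def] by measurable
  have d: "(\<integral>\<^sup>+k. ennreal ((cmod (d n k))\<^sup>2) \<partial>lborel) \<le> ennreal (4 * (1/16)^n)" for n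
  proof -
    have "(\<integral>\<^sup>+k. ennreal ((cmod (d n k))\<^sup>2) \<partial>lborel)
        \<le> 2 * (\<integral>\<^sup>+x. ennreal ((cmod (g (Suc n) x - f x))\<^sup>2) \<partial>lborel) + 2 * (\<integral>\<^sup>+x. ennreal ((cmod (g n x - f x))\<^sup>2) \<partial>lborel)"
      unfolding d_def by (rule fourier_Bessel_diff[OF g g]) simp
    also have "\<dots> \<le> 2 * ennreal ((1/16)^Suc n) + 2 * ennreal ((1/16)^n)"
      by (intro add_mono mult_left_mono \<tau>) simp_all
    also have "\<dots> = ennreal (2 * (1/16)^Suc n + 2 * (1/16)^n)"
      by (simp add: ennreal_plus ennreal_mult del: power_Suc)
    also have "\<dots> \<le> ennreal (4 * (1/16)^n)"
      by (intro ennreal_leI) simp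
    finally show ?thesis .
  qed
  have "(\<integral>\<^sup>+k. (\<Sum>n. ennreal (4^n * (cmod (d n k))\<^sup>2)) \<partial>lborel) = (\<Sum>n. \<integral>\<^sup>+k. ennreal (4^n * (cmod (d n k))\<^sup>2) \<partial>lborel)"
    by (rule nn_integral_suminf) measurable
  also have "\<dots> \<le> (\<Sum>n. ennreal (4 * (1/4)^n))"
  proof (rule suminf_le)
    fix n
    have "(\<integral>\<^sup>+k. ennreal (4^n * (cmod (d n k))\<^sup>2) \<partial>lborel) = ennreal (4^n) * (\<integral>\<^sup>+k. ennreal ((cmod (d n k))\<^sup>2) \<partial>lborel)"
      by (simp add: ennreal_mult nn_integral_cmult)
    also have "\<dots> \<le> ennreal (4^n) * ennreal (4 * (1/16)^n)"
      by (intro mult_left_mono d) simp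
    also have "\<dots> = ennreal (4^n * (4 * (1/16)^n))"
      by (simp add: ennreal_mult)
    also have "(4::real)^n * (4 * (1/16)^n) = 4 * (1/4)^n"
      by (simp add: power_mult_distrib[symmetric])
    finally show "(\<integral>\<^sup>+k. ennreal (4^n * (cmod (d n k))\<^sup>2) \<partial>lborel) \<le> ennreal (4 * (1/4)^n)" .
  qed auto
  also have "\<dots> < \<infinity>"
  proof -
    have "summable (\<lambda>n. 4 * (1/4::real)^n)" by (intro summable_mult summable_geometric) simp
    then have "(\<Sum>n. ennreal (4 * (1/4)^n)) \<noteq> top" by (rule ennreal_suminf_neq_top) simp
    then show ?thesis by (simp only: infinity_ennreal_def less_top)
  qed
  finally have "(\<integral>\<^sup>+k. (\<Sum>n. ennreal (4^n * (cmod (d n k))\<^sup>2)) \<partial>lborel) \<noteq> \<infinity>" by simp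
  then have "AE k in lborel. (\<Sum>n. ennreal (4^n * (cmod (d n k))\<^sup>2)) \<noteq> \<infinity>"
    by (intro nn_integral_PInf_AE) measurable
  then have lim: "AE k in lborel. (\<lambda>n. fourier (g n) k) \<longlonglongrightarrow> lim (\<lambda>n. fourier (g n) k)"
  proof eventually_elim
    fix k assume fin: "(\<Sum>n. ennreal (4^n * (cmod (d n k))\<^sup>2)) \<noteq> \<infinity>"
    define K where "K = enn2real (\<Sum>n. ennreal (4^n * (cmod (d n k))\<^sup>2))"
    have K0: "0 \<le> K" unfolding K_def by (rule enn2real_nonneg)
    have term_le: "t n \<le> (\<Sum>n. t n)" for n and t :: "nat \<Rightarrow> ennreal"
      using sum_le_suminf[of t "{n}"] by simp
    have "summable (\<lambda>n. d n k)"
    proof (rule summable_comparison_test')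
      show "summable (\<lambda>n. sqrt K * (1/2)^n)" by (intro summable_mult summable_geometric) simp
      fix n
      have "ennreal (4^n * (cmod (d n k))\<^sup>2) \<le> (\<Sum>n. ennreal (4^n * (cmod (d n k))\<^sup>2))"
        by (rule term_le)
      also have "\<dots> = ennreal K" using fin unfolding K_def infinity_ennreal_def less_top by (rule ennreal_enn2real[symmetric])
      finally have "4^n * (cmod (d n k))\<^sup>2 \<le> K"
        using K0 by (simp only: ennreal_le_iff)
      then have "sqrt (4^n * (cmod (d n k))\<^sup>2) \<le> sqrt K" by simp
      moreover have "sqrt (4^n) = (2::real)^n" by (simp add: real_sqrt_power)
      ultimately have "2^n * cmod (d n k) \<le> sqrt K" by (simp add: real_sqrt_mult)
      then show "norm (d n k) \<le> sqrt K * (1/2)^n"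
        by (simp add: power_one_over field_simps)
    qed
    then have "convergent (\<lambda>n. \<Sum>i<n. d i k)"
      by (simp add: summable_iff_convergent)
    moreover have "(\<Sum>i<n. d i k) = fourier (g n) k - fourier (g 0) k" for n
      unfolding d_def by (rule sum_lessThan_telescope)
    ultimately have "convergent (\<lambda>n. fourier (g n) k - fourier (g 0) k)" by simp
    then have "convergent (\<lambda>n. fourier (g n) k)"
      using convergent_diff_const_right_iff by blast
    then show "(\<lambda>n. fourier (g n) k) \<longlonglongrightarrow> lim (\<lambda>n. fourier (g n) k)"
      by (simp add: convergent_LIMSEQ_iff)
  qed
  have "(\<lambda>k. lim (\<lambda>n. fourier (g n) k)) \<in> borel_measurable borel"
    by (intro borel_measurable_lim_metric) measurable
  from is_L2_fourier_limit[OF f g conv this lim] show ?thesis by blast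
qed

lemma is_L2_fourier_L2_fourier: "f \<in> L2 \<Longrightarrow> is_L2_fourier f (L2_fourier f)"
  unfolding L2_fourier_def by (rule someI_ex[OF is_L2_fourier_ex])

lemma L2_fourier_eqI:
  "f \<in> L2 \<Longrightarrow> is_L2_fourier f F \<Longrightarrow> AE k in lborel. L2_fourier f k = F k"
  by (rule is_L2_fourier_unique[OF _ is_L2_fourier_L2_fourier])

lemma L2_fourier_L2: "f \<in> L2 \<Longrightarrow> L2_fourier f \<in> L2"
  using is_L2_fourier_L2_fourier[of f] by (simp add: is_L2_fourier_def)

text \<open>
  By \<open>fourier_damped_inverse\<close>, the transform of the damped inverse transform of \<open>F\<close> is a Gaussian
  average of \<open>F\<close>, which converges at every point because \<open>F\<close> is continuous and bounded. This
  verifies the pointwise hypothesis of \<open>is_L2_fourier_limit\<close>, although the inverse transform itself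
  may fail to be integrable.
\<close>

lemma L2_fourier_inversion:
  fixes F :: "real^'n \<Rightarrow> complex"
  assumes F: "integrable lborel F" and cont: "continuous_on UNIV F" and B: "\<And>k. cmod (F k) \<le> B"
  shows "(\<lambda>x. fourier F (- x)) \<in> L2" "is_L2_fourier (\<lambda>x. fourier F (- x)) F"
proof -
  have [measurable]: "F \<in> borel_measurable borel" using borel_measurable_integrable[OF F] by simp
  let ?\<phi> = "\<lambda>x. fourier F (- x)"
  let ?e = "\<lambda>s (x::real^'n). exp (- (norm (s *\<^sub>R x))\<^sup>2 / 2)"
  let ?s = "\<lambda>n. inverse (real (Suc n))"
  have "integrable lborel (\<lambda>k. (cmod (F k))\<^sup>2)"
  proof (rule Bochner_Integration.integrable_bound)
    show "integrable lborel (\<lambda>k. B * cmod (F k))" using F by simp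
    show "AE k in lborel. norm ((cmod (F k))\<^sup>2) \<le> norm (B * cmod (F k))"
      using B by (auto intro!: AE_I2 mult_right_mono intro: order_trans[OF _ abs_ge_self] simp: power2_eq_square abs_mult)
  qed measurable
  then have "(\<integral>\<^sup>+k. ennreal ((cmod (F k))\<^sup>2) \<partial>lborel) < \<infinity>"
    by (simp add: integrable_iff_bounded)
  moreover have "(\<integral>\<^sup>+x. ennreal ((cmod (?\<phi> x))\<^sup>2) \<partial>lborel) \<le> (\<integral>\<^sup>+k. ennreal ((cmod (F k))\<^sup>2) \<partial>lborel)"
  proof -
    have "cmod (?\<phi> x) = cmod (fourier (\<lambda>k. cnj (F k)) x)" for x
      using cnj_fourier[of F "- x"] complex_mod_cnj[of "fourier F (- x)"] by simp
    then show ?thesis using fourier_Bessel[of "\<lambda>k. cnj (F k)"] F by simp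
  qed
  ultimately show \<phi>: "?\<phi> \<in> L2"
    by (simp add: L2_iff_nn_integral)
  show "is_L2_fourier ?\<phi> F"
  proof (rule is_L2_fourier_limit[OF \<phi>])
    let ?g = "\<lambda>n x. ?\<phi> x * of_real (?e (?s n) x)"
    show "integrable lborel (?g n)" for n
    proof (rule Bochner_Integration.integrable_bound)
      let ?M = "(2 * pi) powr (- real CARD('n) / 2) * (LINT x|lborel. cmod (F x))"
      show "integrable lborel (\<lambda>x::real^'n. ?M * ?e (?s n) x)"
        by (intro integrable_mult_right integrable_gauss_damping) simp
      show "AE x in lborel. norm (?g n x) \<le> norm (?M * ?e (?s n) x)"
        using cmod_fourier_le[of F]
        by (auto intro!: AE_I2 mult_right_mono intro: order_trans[OF _ abs_ge_self] simp: norm_mult abs_mult)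
    qed measurable
    have "(\<lambda>n. \<integral>\<^sup>+x. ennreal ((cmod (?g n x - ?\<phi> x))\<^sup>2) \<partial>lborel) \<longlonglongrightarrow> (\<integral>\<^sup>+(x::real^'n). 0 \<partial>lborel)"
    proof (rule nn_integral_dominated_convergence[where w="\<lambda>x. ennreal ((cmod (?\<phi> x))\<^sup>2)"])
      show "(\<integral>\<^sup>+x. ennreal ((cmod (?\<phi> x))\<^sup>2) \<partial>lborel) < \<infinity>"
        using \<phi> by (simp add: L2_iff_nn_integral)
      show "AE x in lborel. ennreal ((cmod (?g n x - ?\<phi> x))\<^sup>2) \<le> ennreal ((cmod (?\<phi> x))\<^sup>2)" for n
      proof (intro AE_I2 ennreal_leI power_mono)
        fix x
        have "?g n x - ?\<phi> x = ?\<phi> x * of_real (?e (?s n) x - 1)" by (simp add: algebra_simps)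
        then have "cmod (?g n x - ?\<phi> x) = cmod (?\<phi> x) * \<bar>?e (?s n) x - 1\<bar>"
          by (simp only: norm_mult norm_of_real)
        also have "\<dots> \<le> cmod (?\<phi> x) * 1" by (intro mult_left_mono) (auto simp: abs_le_iff)
        finally show "cmod (?g n x - ?\<phi> x) \<le> cmod (?\<phi> x)" by simp
      qed simp
      have "(\<lambda>n. ennreal ((cmod (?g n x - ?\<phi> x))\<^sup>2)) \<longlonglongrightarrow> ennreal ((cmod (?\<phi> x * of_real (?e 0 x) - ?\<phi> x))\<^sup>2)" for x
        by (intro tendsto_intros LIMSEQ_inverse_real_of_nat) simp_all
      then show "AE x in lborel. (\<lambda>n. ennreal ((cmod (?g n x - ?\<phi> x))\<^sup>2)) \<longlonglongrightarrow> 0" by simp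
    qed measurable
    then show "(\<lambda>n. \<integral>\<^sup>+x. ennreal ((cmod (?g n x - ?\<phi> x))\<^sup>2) \<partial>lborel) \<longlonglongrightarrow> 0" by simp
    show "AE k in lborel. (\<lambda>n. fourier (?g n) k) \<longlonglongrightarrow> F k"
    proof (rule AE_I2)
      fix k
      have "(\<lambda>n. LINT z|lborel. F (k + ?s n *\<^sub>R z) * of_real (gauss z)) \<longlonglongrightarrow> (LINT z|lborel. F k * of_real (gauss (z::real^'n)))"
      proof (rule integral_dominated_convergence[where w="\<lambda>z::real^'n. B * gauss z"])
        show "integrable lborel (\<lambda>z::real^'n. B * gauss z)"
          by (intro integrable_mult_right gauss_integral)
        show "AE z in lborel. norm (F (k + ?s n *\<^sub>R z) * of_real (gauss z)) \<le> B * gauss z" for n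
          using B by (auto intro!: AE_I2 mult_right_mono simp: norm_mult gauss_nonneg)
        show "AE z in lborel. (\<lambda>n. F (k + ?s n *\<^sub>R z) * of_real (gauss z)) \<longlonglongrightarrow> F k * of_real (gauss z)"
        proof (intro AE_I2 tendsto_mult tendsto_const)
          fix z :: "real^'n"
          have "(\<lambda>n. k + ?s n *\<^sub>R z) \<longlonglongrightarrow> k + 0 *\<^sub>R z"
            by (intro tendsto_intros LIMSEQ_inverse_real_of_nat)
          then have "(\<lambda>n. k + ?s n *\<^sub>R z) \<longlonglongrightarrow> k" by simp
          then show "(\<lambda>n. F (k + ?s n *\<^sub>R z)) \<longlonglongrightarrow> F k"
            using cont by (auto simp: continuous_on_eq_continuous_at intro: isCont_tendsto_compose)
        qed
      qed (simp_all add: gauss_def)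
      also have "(LINT z|lborel. F k * of_real (gauss (z::real^'n))) = F k"
        using gauss_integral(2)[where 'n='n] by simp
      finally show "(\<lambda>n. fourier (?g n) k) \<longlonglongrightarrow> F k"
        by (subst fourier_damped_inverse[OF F]) simp_all
    qed
  qed simp
qed

section \<open>The quadratic form\<close>

definition energy :: "(real^'n \<Rightarrow> real) \<Rightarrow> (real^'n \<Rightarrow> real) \<Rightarrow> real \<Rightarrow> (real^'n \<Rightarrow> complex) \<Rightarrow> real" where
  "energy a V \<sigma> \<psi> = (LINT k|lborel. a k * (cmod (L2_fourier \<psi> k))\<^sup>2) - \<sigma> * (LINT x|lborel. V x * (cmod (\<psi> x))\<^sup>2)"

lemma form_self: "form a V \<sigma> \<psi> \<psi> = of_real (energy a V \<sigma> \<psi>)"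
proof -
  have *: "complex_of_real r * z * cnj z = complex_of_real (r * (cmod z)\<^sup>2)" for r z
    by (simp only: of_real_mult complex_norm_square mult.assoc)
  show ?thesis
    unfolding form_def energy_def * integral_complex_of_real by simp
qed

lemma cmod_square_diff_le:
  assumes t: "t > 0"
  shows "\<bar>(cmod p)\<^sup>2 - (cmod q)\<^sup>2\<bar> \<le> (1 + 1 / t) * (cmod (p - q))\<^sup>2 + t * (cmod q)\<^sup>2"
proof -
  let ?e = "cmod (p - q)"
  have "\<bar>(cmod p)\<^sup>2 - (cmod q)\<^sup>2\<bar> = \<bar>cmod p - cmod q\<bar> * (cmod p + cmod q)"
    by (simp add: power2_eq_square abs_mult square_diff_square_factored)
  also have "\<dots> \<le> ?e * (?e + 2 * cmod q)"
    using norm_triangle_ineq3[of p q] norm_triangle_ineq2[of p q] by (intro mult_mono) auto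
  also have "\<dots> \<le> (1 + 1 / t) * ?e\<^sup>2 + t * (cmod q)\<^sup>2"
  proof -
    have "0 \<le> (?e - t * cmod q)\<^sup>2 / t" using t by simp
    also have "\<dots> = ?e\<^sup>2 / t - 2 * ?e * cmod q + t * (cmod q)\<^sup>2"
      using t by (simp add: power2_eq_square field_simps)
    finally show ?thesis by (simp add: power2_eq_square algebra_simps)
  qed
  finally show ?thesis .
qed

lemma weighted_square_integral_diff_le:
  fixes v :: "'a \<Rightarrow> real" and p q :: "'a \<Rightarrow> complex"
  assumes [measurable]: "v \<in> borel_measurable M" "p \<in> borel_measurable M" "q \<in> borel_measurable M"
    and p: "integrable M (\<lambda>x. v x * (cmod (p x))\<^sup>2)" and q: "integrable M (\<lambda>x. v x * (cmod (q x))\<^sup>2)"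
    and t: "t > 0"
  shows "\<bar>(LINT x|M. v x * (cmod (p x))\<^sup>2) - (LINT x|M. v x * (cmod (q x))\<^sup>2)\<bar>
    \<le> (1 + 1 / t) * (LINT x|M. \<bar>v x\<bar> * (cmod (p x - q x))\<^sup>2) + t * (LINT x|M. \<bar>v x\<bar> * (cmod (q x))\<^sup>2)"
proof -
  have ap: "integrable M (\<lambda>x. \<bar>v x\<bar> * (cmod (p x))\<^sup>2)" and aq: "integrable M (\<lambda>x. \<bar>v x\<bar> * (cmod (q x))\<^sup>2)"
    using integrable_abs[OF p] integrable_abs[OF q] by (simp_all add: abs_mult)
  have diff: "integrable M (\<lambda>x. \<bar>v x\<bar> * (cmod (p x - q x))\<^sup>2)"
  proof (rule Bochner_Integration.integrable_bound)
    show "integrable M (\<lambda>x. 2 * (\<bar>v x\<bar> * (cmod (p x))\<^sup>2) + 2 * (\<bar>v x\<bar> * (cmod (q x))\<^sup>2))"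
      using ap aq by simp
    show "AE x in M. norm (\<bar>v x\<bar> * (cmod (p x - q x))\<^sup>2) \<le> norm (2 * (\<bar>v x\<bar> * (cmod (p x))\<^sup>2) + 2 * (\<bar>v x\<bar> * (cmod (q x))\<^sup>2))"
    proof (rule AE_I2)
      fix x
      have "(cmod (p x - q x))\<^sup>2 \<le> (cmod (p x) + cmod (q x))\<^sup>2"
        by (intro power_mono norm_triangle_ineq4) simp
      also have "\<dots> \<le> 2 * (cmod (p x))\<^sup>2 + 2 * (cmod (q x))\<^sup>2"
        using sum_squares_bound[of "cmod (p x)" "cmod (q x)"] by (simp add: power2_sum)
      finally have "\<bar>v x\<bar> * (cmod (p x - q x))\<^sup>2 \<le> \<bar>v x\<bar> * (2 * (cmod (p x))\<^sup>2 + 2 * (cmod (q x))\<^sup>2)"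
        by (rule mult_left_mono) simp
      then show "norm (\<bar>v x\<bar> * (cmod (p x - q x))\<^sup>2) \<le> norm (2 * (\<bar>v x\<bar> * (cmod (p x))\<^sup>2) + 2 * (\<bar>v x\<bar> * (cmod (q x))\<^sup>2))"
        by (simp add: algebra_simps)
    qed
  qed measurable
  have "\<bar>(LINT x|M. v x * (cmod (p x))\<^sup>2) - (LINT x|M. v x * (cmod (q x))\<^sup>2)\<bar>
    = \<bar>LINT x|M. v x * (cmod (p x))\<^sup>2 - v x * (cmod (q x))\<^sup>2\<bar>"
    by (subst Bochner_Integration.integral_diff[OF p q]) simp
  also have "\<dots> \<le> (LINT x|M. \<bar>v x * (cmod (p x))\<^sup>2 - v x * (cmod (q x))\<^sup>2\<bar>)"
    by (rule integral_abs_bound)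
  also have "\<dots> \<le> (LINT x|M. (1 + 1 / t) * (\<bar>v x\<bar> * (cmod (p x - q x))\<^sup>2) + t * (\<bar>v x\<bar> * (cmod (q x))\<^sup>2))"
  proof (rule integral_mono)
    show "integrable M (\<lambda>x. \<bar>v x * (cmod (p x))\<^sup>2 - v x * (cmod (q x))\<^sup>2\<bar>)"
      using p q by (intro integrable_abs Bochner_Integration.integrable_diff)
    show "integrable M (\<lambda>x. (1 + 1 / t) * (\<bar>v x\<bar> * (cmod (p x - q x))\<^sup>2) + t * (\<bar>v x\<bar> * (cmod (q x))\<^sup>2))"
      using diff aq by (intro Bochner_Integration.integrable_add integrable_mult_right)
    fix x
    have "\<bar>v x * (cmod (p x))\<^sup>2 - v x * (cmod (q x))\<^sup>2\<bar> = \<bar>v x\<bar> * \<bar>(cmod (p x))\<^sup>2 - (cmod (q x))\<^sup>2\<bar>"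
      by (simp add: abs_mult flip: right_diff_distrib)
    also have "\<dots> \<le> \<bar>v x\<bar> * ((1 + 1 / t) * (cmod (p x - q x))\<^sup>2 + t * (cmod (q x))\<^sup>2)"
      by (intro mult_left_mono cmod_square_diff_le t) simp
    finally show "\<bar>v x * (cmod (p x))\<^sup>2 - v x * (cmod (q x))\<^sup>2\<bar>
        \<le> (1 + 1 / t) * (\<bar>v x\<bar> * (cmod (p x - q x))\<^sup>2) + t * (\<bar>v x\<bar> * (cmod (q x))\<^sup>2)"
      by (simp add: algebra_simps)
  qed
  also have "\<dots> = (1 + 1 / t) * (LINT x|M. \<bar>v x\<bar> * (cmod (p x - q x))\<^sup>2) + t * (LINT x|M. \<bar>v x\<bar> * (cmod (q x))\<^sup>2)"
    by (subst Bochner_Integration.integral_add)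
      (use diff aq in \<open>auto intro: integrable_mult_right simp only: integral_mult_right_zero\<close>)
  finally show ?thesis .
qed

text \<open>
  The energy is continuous in the norm that defines form cores. By \<open>cmod_square_diff_le\<close>, either
  part of \<open>E(\<psi>) - E(\<phi>)\<close> is bounded by \<open>1 + 1/t\<close> times the distance of \<open>\<psi>\<close> and \<open>\<phi>\<close> plus \<open>t\<close> times
  a quantity that depends on \<open>\<phi>\<close> only; first \<open>t\<close> and then the distance is chosen small.
\<close>

lemma energy_nonneg_if_nonneg_on_core:
  fixes a V :: "real^'n \<Rightarrow> real"
  assumes a[measurable]: "a \<in> borel_measurable borel" and a0: "\<And>k. 0 \<le> a k"
    and V[measurable]: "V \<in> borel_measurable borel" and \<sigma>: "\<sigma> > 0"
    and core: "form_core a V D" and D: "\<And>\<psi>. \<psi> \<in> D \<Longrightarrow> 0 \<le> energy a V \<sigma> \<psi>"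
    and \<phi>: "\<phi> \<in> form_domain a V"
  shows "0 \<le> energy a V \<sigma> \<phi>"
proof (rule ccontr)
  assume "\<not> ?thesis"
  then have neg: "energy a V \<sigma> \<phi> < 0" by simp
  define \<delta> where "\<delta> = - energy a V \<sigma> \<phi>"
  have \<delta>: "\<delta> > 0" using neg by (simp add: \<delta>_def)
  define K where "K = (LINT k|lborel. a k * (cmod (L2_fourier \<phi> k))\<^sup>2) + \<sigma> * (LINT x|lborel. \<bar>V x\<bar> * (cmod (\<phi> x))\<^sup>2)"
  have K: "0 \<le> K" unfolding K_def using a0 \<sigma>
    by (intro add_nonneg_nonneg mult_nonneg_nonneg integral_nonneg_AE) auto
  define t where "t = \<delta> / (2 * (K + 1))"
  have t: "t > 0" using \<delta> K by (simp add: t_def)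
  have "t * K < t * (K + 1)" using t by simp
  also have "\<dots> = \<delta> / 2"
  proof -
    have "K + 1 \<noteq> 0" using K by simp
    then show ?thesis unfolding t_def by (metis mult.commute nonzero_mult_div_cancel_left times_divide_eq_left mult_divide_mult_cancel_left)
  qed
  finally have tK: "t * K < \<delta> / 2" .
  define P where "P = (1 + 1 / t) * (1 + \<sigma>)"
  define \<epsilon> where "\<epsilon> = \<delta> / (2 * P)"
  have pos: "P > 0" unfolding P_def using t \<sigma> by (intro mult_pos_pos add_pos_pos) auto
  have \<epsilon>: "\<epsilon> > 0" using \<delta> pos by (simp add: \<epsilon>_def)
  have "P * \<epsilon> = \<delta> / 2" using pos by (simp add: \<epsilon>_def)
  then have \<epsilon>': "(1 + 1 / t) * ((1 + \<sigma>) * \<epsilon>) = \<delta> / 2" by (simp only: P_def mult.assoc)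
  obtain \<psi> where \<psi>: "\<psi> \<in> D" and close:
    "(LINT x|lborel. (cmod (\<psi> x - \<phi> x))\<^sup>2) +
     (LINT k|lborel. a k * (cmod (L2_fourier \<psi> k - L2_fourier \<phi> k))\<^sup>2) +
     (LINT x|lborel. \<bar>V x\<bar> * (cmod (\<psi> x - \<phi> x))\<^sup>2) < \<epsilon>"
    using core \<phi> \<epsilon> unfolding form_core_def by blast
  have \<psi>': "\<psi> \<in> form_domain a V" using core \<psi> by (auto simp: form_core_def)
  let ?A = "LINT k|lborel. a k * (cmod (L2_fourier \<psi> k - L2_fourier \<phi> k))\<^sup>2"
  let ?B = "LINT x|lborel. \<bar>V x\<bar> * (cmod (\<psi> x - \<phi> x))\<^sup>2"
  have "0 \<le> (LINT x|lborel. (cmod (\<psi> x - \<phi> x))\<^sup>2)" "0 \<le> ?A" "0 \<le> ?B"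
    using a0 by (auto intro!: integral_nonneg_AE)
  then have AB: "?A \<le> \<epsilon>" "?B \<le> \<epsilon>" using close by linarith+
  have L: "\<phi> \<in> L2" "\<psi> \<in> L2" using \<phi> \<psi>' by (auto simp: form_domain_def)
  note [measurable] = L[THEN L2_measurable] L[THEN L2_fourier_L2, THEN L2_measurable]
  have "\<bar>(LINT k|lborel. a k * (cmod (L2_fourier \<psi> k))\<^sup>2) - (LINT k|lborel. a k * (cmod (L2_fourier \<phi> k))\<^sup>2)\<bar>
    \<le> (1 + 1 / t) * (LINT k|lborel. \<bar>a k\<bar> * (cmod (L2_fourier \<psi> k - L2_fourier \<phi> k))\<^sup>2)
      + t * (LINT k|lborel. \<bar>a k\<bar> * (cmod (L2_fourier \<phi> k))\<^sup>2)"
    using \<phi> \<psi>' by (intro weighted_square_integral_diff_le t) (auto simp: form_domain_def)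
  then have 1: "(LINT k|lborel. a k * (cmod (L2_fourier \<psi> k))\<^sup>2) \<le> (LINT k|lborel. a k * (cmod (L2_fourier \<phi> k))\<^sup>2)
      + (1 + 1 / t) * ?A + t * (LINT k|lborel. a k * (cmod (L2_fourier \<phi> k))\<^sup>2)"
    using a0 by simp
  have "\<bar>(LINT x|lborel. V x * (cmod (\<psi> x))\<^sup>2) - (LINT x|lborel. V x * (cmod (\<phi> x))\<^sup>2)\<bar>
    \<le> (1 + 1 / t) * ?B + t * (LINT x|lborel. \<bar>V x\<bar> * (cmod (\<phi> x))\<^sup>2)"
    using \<phi> \<psi>' by (intro weighted_square_integral_diff_le t) (auto simp: form_domain_def)
  then have "(LINT x|lborel. V x * (cmod (\<phi> x))\<^sup>2) - (LINT x|lborel. V x * (cmod (\<psi> x))\<^sup>2)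
    \<le> (1 + 1 / t) * ?B + t * (LINT x|lborel. \<bar>V x\<bar> * (cmod (\<phi> x))\<^sup>2)"
    by linarith
  from mult_left_mono[OF this, of \<sigma>]
  have 2: "\<sigma> * (LINT x|lborel. V x * (cmod (\<phi> x))\<^sup>2) - \<sigma> * (LINT x|lborel. V x * (cmod (\<psi> x))\<^sup>2)
    \<le> (1 + 1 / t) * (\<sigma> * ?B) + t * (\<sigma> * (LINT x|lborel. \<bar>V x\<bar> * (cmod (\<phi> x))\<^sup>2))"
    using \<sigma> by (simp add: algebra_simps)
  have "energy a V \<sigma> \<psi> \<le> energy a V \<sigma> \<phi> + (1 + 1 / t) * (?A + \<sigma> * ?B) + t * K"
    using 1 2 by (simp only: energy_def K_def distrib_left)
  also have "(1 + 1 / t) * (?A + \<sigma> * ?B) \<le> (1 + 1 / t) * ((1 + \<sigma>) * \<epsilon>)"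
  proof (rule mult_left_mono)
    show "?A + \<sigma> * ?B \<le> (1 + \<sigma>) * \<epsilon>"
      using AB(1) mult_left_mono[OF AB(2) less_imp_le[OF \<sigma>]] by (simp only: distrib_right mult_1 add_mono)
    show "0 \<le> 1 + 1 / t" using t by simp
  qed
  finally have "energy a V \<sigma> \<psi> \<le> - \<delta> + \<delta> / 2 + t * K" by (simp add: \<epsilon>' \<delta>_def)
  moreover have "0 \<le> energy a V \<sigma> \<psi>" by (rule D[OF \<psi>])
  ultimately show False using tK by linarith
qed

lemma energy_nonneg_if_no_negative_spectrum:
  fixes a V :: "real^'n \<Rightarrow> real"
  assumes a: "a \<in> borel_measurable borel" "\<And>k. 0 \<le> a k"
    and V: "V \<in> borel_measurable borel" and \<sigma>: "\<sigma> > 0"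
    and wd: "well_defined_hamiltonian a V \<sigma>"
    and empty: "negative_spectrum (hamiltonian a V \<sigma>) = {}"
    and \<phi>: "\<phi> \<in> form_domain a V"
  shows "0 \<le> energy a V \<sigma> \<phi>"
proof (rule energy_nonneg_if_nonneg_on_core[OF a V \<sigma> _ _ \<phi>])
  let ?H = "hamiltonian a V \<sigma>"
  show "form_core a V (Domain ?H)" using wd by (simp add: well_defined_hamiltonian_def)
  have adj: "adjoint_op ?H = ?H" using wd by (simp add: well_defined_hamiltonian_def self_adjoint_def)
  have res: "complex_of_real \<mu> \<in> resolvent_set ?H" if "\<mu> < 0" for \<mu>
    using empty that by (auto simp: negative_spectrum_def op_spectrum_def)
  fix \<psi> assume "\<psi> \<in> Domain ?H"
  then obtain \<eta> where \<eta>: "(\<psi>, \<eta>) \<in> ?H" by blast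
  then have "form a V \<sigma> \<psi> \<psi> = L2_inner \<eta> \<psi>" by (auto simp: hamiltonian_def)
  then have "complex_of_real (energy a V \<sigma> \<psi>) = L2_inner \<eta> \<psi>" by (simp only: form_self)
  then have "energy a V \<sigma> \<psi> = Re (L2_inner \<eta> \<psi>)" by (metis Re_complex_of_real)
  then show "0 \<le> energy a V \<sigma> \<psi>" using self_adjoint_nonneg[OF adj res \<eta>] by simp
qed

section \<open>Trial functions with negative energy\<close>

text \<open>
  For \<open>r < \<rho>\<close> this is \<open>|k|\<^sup>-\<^sup>d\<close> cut off at height \<open>r\<^sup>-\<^sup>d\<close> near the origin and lowered by
  \<open>\<rho>\<^sup>-\<^sup>d\<close>, so that it reaches zero continuously at \<open>|k| = \<rho>\<close>. Continuity is what Fourier inversion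
  needs, and the bounded support makes the energy finite for every continuous symbol.
\<close>

definition log_bump :: "real \<Rightarrow> real \<Rightarrow> real^'n \<Rightarrow> real" where
  "log_bump \<rho> r k = max 0 (1 / max (norm k) r ^ CARD('n) - 1 / \<rho> ^ CARD('n))"

lemma log_bump_nonneg: "0 \<le> log_bump \<rho> r (k::real^'n)" by (simp add: log_bump_def)

lemma log_bump_le:
  assumes "r > 0" "\<rho> > 0"
  shows "log_bump \<rho> r (k::real^'n) \<le> 1 / r ^ CARD('n)"
proof -
  have "1 / max (norm k) r ^ CARD('n) \<le> 1 / r ^ CARD('n)"
    using assms by (intro divide_left_mono power_mono mult_pos_pos) auto
  moreover have "0 \<le> 1 / \<rho> ^ CARD('n)" "0 \<le> 1 / r ^ CARD('n)" using assms by simp_all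
  ultimately show ?thesis unfolding log_bump_def by linarith
qed

text \<open>
  Because of this bound, \<open>\<integral> |k|\<^sup>d F\<^sup>2 \<le> 1/I\<close> if \<open>F\<close> is the function divided by its integral \<open>I\<close>.
\<close>

lemma log_bump_norm_le:
  assumes "r > 0" "\<rho> > 0"
  shows "norm k ^ CARD('n) * log_bump \<rho> r (k::real^'n) \<le> 1"
proof -
  have "0 \<le> 1 / \<rho> ^ CARD('n)" "0 \<le> 1 / max (norm k) r ^ CARD('n)" using assms by simp_all
  then have "log_bump \<rho> r k \<le> 1 / max (norm k) r ^ CARD('n)"
    unfolding log_bump_def by linarith
  then have "norm k ^ CARD('n) * log_bump \<rho> r k \<le> max (norm k) r ^ CARD('n) * (1 / max (norm k) r ^ CARD('n))"
    using assms by (intro mult_mono power_mono log_bump_nonneg) auto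
  also have "\<dots> = 1" using assms by simp
  finally show ?thesis .
qed

lemma log_bump_eq_0:
  assumes "r > 0" "\<rho> > 0" "norm k \<ge> \<rho>"
  shows "log_bump \<rho> r (k::real^'n) = 0"
proof -
  have "1 / max (norm k) r ^ CARD('n) \<le> 1 / \<rho> ^ CARD('n)"
    using assms by (intro divide_left_mono power_mono mult_pos_pos) auto
  then show ?thesis by (simp add: log_bump_def)
qed

lemma log_bump_continuous: "r > 0 \<Longrightarrow> continuous_on A (log_bump \<rho> r :: real^'n \<Rightarrow> real)"
  unfolding log_bump_def[abs_def] by (intro continuous_intros) auto

lemma log_bump_integrable:
  assumes "r > 0" "\<rho> > 0"
  shows "integrable lborel (log_bump \<rho> r :: real^'n \<Rightarrow> real)"
proof (rule Bochner_Integration.integrable_bound)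
  show "integrable lborel (\<lambda>k::real^'n. indicator (cball 0 \<rho>) k * (1 / r ^ CARD('n)))"
    using emeasure_lborel_cball_finite[of "0::real^'n" \<rho>]
    by (intro integrable_mult_left integrable_real_indicator) auto
  show "log_bump \<rho> r \<in> borel_measurable (lborel :: (real^'n) measure)"
    using borel_measurable_continuous_onI[OF log_bump_continuous[OF assms(1)]] by simp
  show "AE k in lborel. norm (log_bump \<rho> r k) \<le> norm (indicator (cball 0 \<rho>) (k::real^'n) * (1 / r ^ CARD('n)))"
    using log_bump_le[OF assms, where 'n='n] log_bump_nonneg[where 'n='n] log_bump_eq_0[OF assms, where 'n='n] assms
    by (auto simp: indicator_def not_le intro!: AE_I2)
qed

text \<open>
  The logarithmic divergence of \<open>\<integral> |k|\<^sup>-\<^sup>d dk\<close> at the origin, one dyadic scale at a time: on the ball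
  of radius \<open>\<rho>/2\<close>, the functions with outer radii \<open>\<rho>\<close> and \<open>\<rho>/2\<close> differ by the constant
  \<open>(2\<^sup>d - 1) \<rho>\<^sup>-\<^sup>d\<close>, and its integral over that ball is independent of \<open>\<rho>\<close>.
\<close>

lemma log_bump_integral_ge:
  assumes "\<rho> > 0"
  shows "real N * ((1 - 1 / 2 ^ CARD('n)) * unit_ball_vol CARD('n))
    \<le> (LINT k|lborel. log_bump \<rho> (\<rho> / 2 ^ N) (k::real^'n))"
  using assms
proof (induction N arbitrary: \<rho>)
  case 0
  then show ?case by (auto intro!: integral_nonneg_AE simp: log_bump_nonneg)
next
  case (Suc N)
  let ?c = "2 ^ CARD('n) / \<rho> ^ CARD('n) - 1 / \<rho> ^ CARD('n)"
  let ?r = "\<rho> / 2 ^ Suc N"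
  have r: "?r > 0" "?r = \<rho> / 2 / 2 ^ N" using Suc.prems by simp_all
  have fin: "integrable lborel (\<lambda>k::real^'n. indicator (ball 0 (\<rho> / 2)) k * ?c)"
    using emeasure_lborel_ball_finite[of "0::real^'n" "\<rho> / 2"]
    by (intro integrable_mult_left integrable_real_indicator) auto
  have vol: "(1 - 1 / 2 ^ CARD('n)) * unit_ball_vol CARD('n) = (LINT k|lborel. indicator (ball 0 (\<rho> / 2)) (k::real^'n) * ?c)"
  proof -
    have "(LINT k|lborel. indicator (ball 0 (\<rho> / 2)) (k::real^'n) * ?c) = measure lborel (ball (0::real^'n) (\<rho> / 2)) * ?c"
      by (simp only: integral_mult_left_zero) simp
    also have "measure lborel (ball (0::real^'n) (\<rho> / 2)) = unit_ball_vol CARD('n) * (\<rho> / 2) ^ CARD('n)"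
      using Suc.prems content_ball[of "\<rho> / 2" "0::real^'n"] by simp
    finally show ?thesis using Suc.prems by (simp add: field_simps)
  qed
  have "real (Suc N) * ((1 - 1 / 2 ^ CARD('n)) * unit_ball_vol CARD('n))
    = real N * ((1 - 1 / 2 ^ CARD('n)) * unit_ball_vol CARD('n)) + (1 - 1 / 2 ^ CARD('n)) * unit_ball_vol CARD('n)"
    by (simp only: of_nat_Suc distrib_right mult_1 add.commute)
  also have "\<dots> \<le> (LINT k|lborel. log_bump (\<rho> / 2) ?r (k::real^'n)) + (1 - 1 / 2 ^ CARD('n)) * unit_ball_vol CARD('n)"
    using Suc.IH[of "\<rho> / 2"] Suc.prems unfolding r(2) by simp
  also have "\<dots> = (LINT k|lborel. log_bump (\<rho> / 2) ?r (k::real^'n)) + (LINT k|lborel. indicator (ball 0 (\<rho> / 2)) (k::real^'n) * ?c)"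
    by (simp only: vol)
  also have "\<dots>
    = (LINT k|lborel. log_bump (\<rho> / 2) ?r k + indicator (ball 0 (\<rho> / 2)) (k::real^'n) * ?c)"
    using Suc.prems by (intro Bochner_Integration.integral_add[symmetric] log_bump_integrable fin) auto
  also have "\<dots> \<le> (LINT k|lborel. log_bump \<rho> ?r (k::real^'n))"
  proof (rule integral_mono)
    show "integrable lborel (\<lambda>k::real^'n. log_bump (\<rho> / 2) ?r k + indicator (ball 0 (\<rho> / 2)) k * ?c)"
      using Suc.prems by (intro Bochner_Integration.integrable_add log_bump_integrable fin) auto
    show "integrable lborel (\<lambda>k::real^'n. log_bump \<rho> ?r k)"
      using Suc.prems by (intro log_bump_integrable) auto
    fix k :: "real^'n"
    show "log_bump (\<rho> / 2) ?r k + indicator (ball 0 (\<rho> / 2)) k * ?c \<le> log_bump \<rho> ?r k"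
    proof (cases "norm k < \<rho> / 2")
      case False
      then have "log_bump (\<rho> / 2) ?r k = 0"
        using Suc.prems by (intro log_bump_eq_0) auto
      then show ?thesis using False log_bump_nonneg[of \<rho> ?r k] by simp
    next
      case True
      have "?r \<le> \<rho> / 2" using Suc.prems by (simp add: field_simps)
      then have "max (norm k) ?r \<le> \<rho> / 2" using True by simp
      moreover have "0 < max (norm k) ?r" using r(1) by (simp only: less_max_iff_disj simp_thms)
      ultimately have "1 / (\<rho> / 2) ^ CARD('n) \<le> 1 / max (norm k) ?r ^ CARD('n)"
        using Suc.prems by (intro divide_left_mono power_mono mult_pos_pos zero_less_power)
          (simp_all only: less_imp_le zero_less_one half_gt_zero)
      then have "log_bump (\<rho> / 2) ?r k = 1 / max (norm k) ?r ^ CARD('n) - 2 ^ CARD('n) / \<rho> ^ CARD('n)"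
        by (simp add: log_bump_def power_divide)
      then show ?thesis using True by (simp add: log_bump_def)
    qed
  qed
  finally show ?case .
qed

lemma log_bump_integral_unbounded:
  assumes "\<rho> > 0"
  shows "\<exists>r>0. L \<le> (LINT k|lborel. log_bump \<rho> r (k::real^'n))"
proof -
  let ?c = "(1 - 1 / 2 ^ CARD('n)) * unit_ball_vol CARD('n)"
  have "(1::real) < 2 ^ CARD('n)" by (intro one_less_power) auto
  then have c: "?c > 0" by (intro mult_pos_pos) auto
  obtain N :: nat where "L / ?c \<le> real N" using real_arch_simple by blast
  then have "L \<le> real N * ?c" using c by (simp only: pos_divide_le_eq)
  also have "\<dots> \<le> (LINT k|lborel. log_bump \<rho> (\<rho> / 2 ^ N) (k::real^'n))"
    by (rule log_bump_integral_ge[OF assms])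
  finally show ?thesis using assms by (intro exI[of _ "\<rho> / 2 ^ N"]) simp
qed

lemma test_density_exists:
  assumes \<rho>: "\<rho> > 0" and L: "L > 0"
  obtains F :: "real^'n \<Rightarrow> real" and B where
    "continuous_on UNIV F" "integrable lborel F" "\<And>k. 0 \<le> F k" "\<And>k. F k \<le> B"
    "\<And>k. norm k \<ge> \<rho> \<Longrightarrow> F k = 0" "(LINT k|lborel. F k) = 1"
    "integrable lborel (\<lambda>k. norm k ^ CARD('n) * (F k)\<^sup>2)"
    "(LINT k|lborel. norm k ^ CARD('n) * (F k)\<^sup>2) \<le> 1 / L"
proof -
  obtain r where r: "r > 0" and Lr: "L \<le> (LINT k|lborel. log_bump \<rho> r (k::real^'n))"
    using log_bump_integral_unbounded[OF \<rho>] by blast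
  define I where "I = (LINT k|lborel. log_bump \<rho> r (k::real^'n))"
  have I: "I > 0" "L \<le> I" using L Lr by (simp_all add: I_def)
  define F where "F k = log_bump \<rho> r k / I" for k :: "real^'n"
  note int = log_bump_integrable[OF r \<rho>, where 'n='n]
  have cont: "continuous_on UNIV F"
    unfolding F_def[abs_def] using log_bump_continuous[OF r] I by (intro continuous_intros) auto
  have le: "norm k ^ CARD('n) * (F k)\<^sup>2 \<le> log_bump \<rho> r k / I\<^sup>2" for k
  proof -
    have "norm k ^ CARD('n) * (F k)\<^sup>2 = (norm k ^ CARD('n) * log_bump \<rho> r k) * (log_bump \<rho> r k / I\<^sup>2)"
      by (simp add: F_def power2_eq_square)
    also have "\<dots> \<le> 1 * (log_bump \<rho> r k / I\<^sup>2)"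
      by (intro mult_right_mono log_bump_norm_le r \<rho> divide_nonneg_nonneg log_bump_nonneg) simp
    finally show ?thesis by simp
  qed
  have int2: "integrable lborel (\<lambda>k. norm k ^ CARD('n) * (F k)\<^sup>2)"
  proof (rule Bochner_Integration.integrable_bound)
    show "integrable lborel (\<lambda>k::real^'n. log_bump \<rho> r k / I\<^sup>2)" using int by simp
    have "continuous_on UNIV (\<lambda>k. norm k ^ CARD('n) * (F k)\<^sup>2)" by (intro continuous_intros cont)
    then show "(\<lambda>k. norm k ^ CARD('n) * (F k)\<^sup>2) \<in> borel_measurable lborel"
      by (simp add: borel_measurable_continuous_onI)
    show "AE k in lborel. norm (norm k ^ CARD('n) * (F k)\<^sup>2) \<le> norm (log_bump \<rho> r k / I\<^sup>2)"
      using le by (auto intro!: AE_I2 simp: abs_mult log_bump_nonneg)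
  qed
  show ?thesis
  proof (rule that[of F "1 / r ^ CARD('n) / I"])
    show "integrable lborel F" unfolding F_def[abs_def] using int by simp
    show "0 \<le> F k" for k using I by (simp add: F_def log_bump_nonneg)
    show "F k \<le> 1 / r ^ CARD('n) / I" for k
      unfolding F_def using I by (intro divide_right_mono log_bump_le r \<rho>) simp
    show "F k = 0" if "norm k \<ge> \<rho>" for k using that by (simp add: F_def log_bump_eq_0 r \<rho>)
    show "(LINT k|lborel. F k) = 1" using I by (simp add: F_def I_def)
    have "(LINT k|lborel. norm k ^ CARD('n) * (F k)\<^sup>2) \<le> (LINT k|lborel. log_bump \<rho> r (k::real^'n) / I\<^sup>2)"
      using int by (intro integral_mono int2 le) simp
    also have "\<dots> = 1 / I" using I by (simp add: I_def[symmetric] power2_eq_square)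
    also have "\<dots> \<le> 1 / L" using I L by (simp add: frac_le)
    finally show "(LINT k|lborel. norm k ^ CARD('n) * (F k)\<^sup>2) \<le> 1 / L" .
  qed (fact cont int2)+
qed

lemma cmod_exp_minus_one_le: "cmod (exp (- \<i> * of_real u) - 1) \<le> \<bar>u\<bar>"
  using iexp_approx1[of "- u" 0] by simp

text \<open>
  The transform of a probability density is close to its value at the origin, uniformly over
  densities supported in a ball of radius \<open>\<rho>\<close>, because \<open>|exp(- i x\<cdot>k) - 1| \<le> |x| |k|\<close>.
\<close>

lemma fourier_density_bounds:
  fixes F :: "real^'n \<Rightarrow> real"
  assumes F: "integrable lborel F" "\<And>k. 0 \<le> F k" "(LINT k|lborel. F k) = 1"
    and supp: "\<And>k. norm k \<ge> \<rho> \<Longrightarrow> F k = 0"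
  defines "N \<equiv> (2 * pi) powr (- real CARD('n) / 2)"
  shows "cmod (fourier (\<lambda>k. of_real (F k)) x) \<le> N"
    and "cmod (fourier (\<lambda>k. of_real (F k)) x - of_real N) \<le> N * (\<rho> * norm x)"
proof -
  show "cmod (fourier (\<lambda>k. of_real (F k)) x) \<le> N"
    using cmod_fourier_le[of "\<lambda>k. of_real (F k)" x] F by (simp add: N_def)
  let ?E = "\<lambda>k. exp (- \<i> * of_real (x \<bullet> k))"
  have intF: "integrable lborel (\<lambda>k. complex_of_real (F k))" using F(1) by (rule integrable_of_real)
  note int = integrable_mult_exp[OF intF, of x] intF
  have "(LINT k|lborel. complex_of_real (F k) * ?E k - of_real (F k)) = (LINT k|lborel. complex_of_real (F k) * ?E k) - 1"
    using F(3) by (subst Bochner_Integration.integral_diff[OF int]) simp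
  then have eq: "fourier (\<lambda>k. of_real (F k)) x - of_real N = of_real N * (LINT k|lborel. complex_of_real (F k) * ?E k - of_real (F k))"
    by (simp only: fourier_def N_def[symmetric] right_diff_distrib mult_1_right)
  have "cmod (LINT k|lborel. complex_of_real (F k) * ?E k - of_real (F k)) \<le> (LINT k|lborel. F k * (\<rho> * norm x))"
  proof (rule Bochner_Integration.integral_norm_bound_integral)
    show "integrable lborel (\<lambda>k. complex_of_real (F k) * ?E k - of_real (F k))"
      using int by (rule Bochner_Integration.integrable_diff)
    show "integrable lborel (\<lambda>k. F k * (\<rho> * norm x))" using F by simp
    fix k
    show "cmod (complex_of_real (F k) * ?E k - of_real (F k)) \<le> F k * (\<rho> * norm x)"
    proof (cases "norm k \<ge> \<rho>")
      case False
      have "complex_of_real (F k) * ?E k - of_real (F k) = of_real (F k) * (?E k - 1)"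
        by (simp add: algebra_simps)
      then have "cmod (complex_of_real (F k) * ?E k - of_real (F k)) = F k * cmod (?E k - 1)"
        using F(2)[of k] by (simp only: norm_mult norm_of_real abs_of_nonneg)
      also have "cmod (?E k - 1) \<le> \<bar>x \<bullet> k\<bar>" by (rule cmod_exp_minus_one_le)
      also have "\<bar>x \<bullet> k\<bar> \<le> norm x * norm k" by (rule Cauchy_Schwarz_ineq2)
      also have "\<dots> \<le> \<rho> * norm x"
        using False by (subst mult.commute) (intro mult_right_mono, auto)
      finally show ?thesis using F(2)[of k] by (simp add: mult_left_mono)
    qed (simp add: supp)
  qed
  also have "\<dots> = \<rho> * norm x" using F(3) by simp
  finally show "cmod (fourier (\<lambda>k. of_real (F k)) x - of_real N) \<le> N * (\<rho> * norm x)"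
    unfolding eq by (simp add: norm_mult N_def mult_left_mono)
qed

text \<open>
  Densities \<open>F\<^sub>n\<close> are taken with supports in the balls of radius \<open>\<delta>/(n + 1)\<close>, inside the ball where
  \<open>a(k) \<le> C|k|\<^sup>d\<close>, and with \<open>\<integral> |k|\<^sup>d F\<^sub>n\<^sup>2 \<le> 1/(n + 1)\<close>. Their inverse transforms are bounded
  uniformly in \<open>n\<close>, so dominated convergence with majorant \<open>const \<cdot> |V|\<close> gives the limit of the
  potential energy for any integrable \<open>V\<close>.
\<close>

lemma negative_energy_exists:
  fixes a V :: "real^'n \<Rightarrow> real"
  assumes a: "continuous_on UNIV a" "\<And>k. 0 \<le> a k"
    and small: "eventually (\<lambda>k. a k \<le> C * norm k ^ CARD('n)) (at 0)"
    and V: "integrable lborel V" "(LINT x|lborel. V x) > 0" and \<sigma>: "\<sigma> > 0"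
  shows "\<exists>\<phi>\<in>form_domain a V. energy a V \<sigma> \<phi> < 0"
proof -
  let ?N = "(2 * pi) powr (- real CARD('n) / 2)"
  have [measurable]: "a \<in> borel_measurable borel" using a(1) by (rule borel_measurable_continuous_onI)
  have [measurable]: "V \<in> borel_measurable borel" using borel_measurable_integrable[OF V(1)] by simp
  obtain \<delta> where \<delta>: "\<delta> > 0" "\<And>k. k \<noteq> 0 \<Longrightarrow> norm k < \<delta> \<Longrightarrow> a k \<le> C * norm k ^ CARD('n)"
    using small unfolding eventually_at by (auto simp: dist_norm)
  define \<rho> where "\<rho> n = \<delta> * inverse (real (Suc n))" for n
  have \<rho>: "\<rho> n > 0" "\<rho> n \<le> \<delta>" for n
    using \<delta>(1) by (auto simp: \<rho>_def field_simps)
  define test where "test n F \<longleftrightarrow> continuous_on UNIV F \<and> integrable lborel F \<and> (\<forall>k. 0 \<le> F k) \<and> (\<exists>B. \<forall>k. F k \<le> B)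
    \<and> (\<forall>k. norm k \<ge> \<rho> n \<longrightarrow> F k = 0) \<and> (LINT k|lborel. F k) = 1
    \<and> integrable lborel (\<lambda>k. norm k ^ CARD('n) * (F k)\<^sup>2)
    \<and> (LINT k|lborel. norm k ^ CARD('n) * (F k)\<^sup>2) \<le> inverse (real (Suc n))" for n and F :: "real^'n \<Rightarrow> real"
  have ex: "\<exists>F. test n F" for n
    by (rule test_density_exists[OF \<rho>(1)[of n], of "real (Suc n)"]) (auto simp: test_def inverse_eq_divide)
  define F where "F n = (SOME F. test n F)" for n
  have "test n (F n)" for n unfolding F_def by (rule someI_ex[OF ex])
  then have F: "continuous_on UNIV (F n)" "integrable lborel (F n)" "\<And>k. 0 \<le> F n k" "\<exists>B. \<forall>k. F n k \<le> B"
    "\<And>k. norm k \<ge> \<rho> n \<Longrightarrow> F n k = 0" "(LINT k|lborel. F n k) = 1"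
    "integrable lborel (\<lambda>k. norm k ^ CARD('n) * (F n k)\<^sup>2)"
    "(LINT k|lborel. norm k ^ CARD('n) * (F n k)\<^sup>2) \<le> inverse (real (Suc n))" for n
    unfolding test_def by auto
  have [measurable]: "F n \<in> borel_measurable borel" for n
    using F(1) by (rule borel_measurable_continuous_onI)
  define \<phi> where "\<phi> n x = fourier (\<lambda>k. of_real (F n k)) (- x)" for n x
  have \<phi>: "\<phi> n \<in> L2" "is_L2_fourier (\<phi> n) (\<lambda>k. of_real (F n k))" for n
  proof -
    obtain B where B: "\<forall>k. F n k \<le> B" using F(4)[of n] by blast
    have int: "integrable lborel (\<lambda>k. complex_of_real (F n k))" using F(2) by simp
    have cont: "continuous_on UNIV (\<lambda>k. complex_of_real (F n k))" by (intro continuous_intros F)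
    have bd: "cmod (complex_of_real (F n k)) \<le> B" for k using B F(3) by simp
    show "\<phi> n \<in> L2" "is_L2_fourier (\<phi> n) (\<lambda>k. of_real (F n k))"
      using L2_fourier_inversion[OF int cont bd] by (simp_all add: \<phi>_def[abs_def])
  qed
  note [measurable] = \<phi>(1)[THEN L2_measurable] \<phi>(1)[THEN L2_fourier_L2, THEN L2_measurable]
  have hat: "AE k in lborel. a k * (cmod (L2_fourier (\<phi> n) k))\<^sup>2 = a k * (F n k)\<^sup>2" for n
    using L2_fourier_eqI[OF \<phi>(1)[of n] \<phi>(2)] by eventually_elim simp
  have le: "AE k in lborel. a k * (F n k)\<^sup>2 \<le> C * (norm k ^ CARD('n) * (F n k)\<^sup>2)" for n
  proof -
    have "AE k in lborel. k \<noteq> (0 :: real^'n)" by (rule AE_lborel_singleton)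
    then show ?thesis
    proof eventually_elim
      fix k :: "real^'n" assume "k \<noteq> 0"
      show "a k * (F n k)\<^sup>2 \<le> C * (norm k ^ CARD('n) * (F n k)\<^sup>2)"
      proof (cases "norm k < \<rho> n")
        case True
        then have "a k \<le> C * norm k ^ CARD('n)" using \<rho>(2)[of n] by (intro \<delta>(2) \<open>k \<noteq> 0\<close>) simp
        from mult_right_mono[OF this, of "(F n k)\<^sup>2"] show ?thesis by (simp add: mult.assoc)
      qed (simp add: F(5))
    qed
  qed
  have int_aF: "integrable lborel (\<lambda>k. a k * (F n k)\<^sup>2)" for n
  proof (rule Bochner_Integration.integrable_bound)
    show "integrable lborel (\<lambda>k. C * (norm k ^ CARD('n) * (F n k)\<^sup>2))" using F(7) by (rule integrable_mult_right)
    show "AE k in lborel. norm (a k * (F n k)\<^sup>2) \<le> norm (C * (norm k ^ CARD('n) * (F n k)\<^sup>2))"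
      using le[of n]
    proof eventually_elim
      fix k assume "a k * (F n k)\<^sup>2 \<le> C * (norm k ^ CARD('n) * (F n k)\<^sup>2)"
      moreover have "0 \<le> a k * (F n k)\<^sup>2" using a(2) by simp
      ultimately show "norm (a k * (F n k)\<^sup>2) \<le> norm (C * (norm k ^ CARD('n) * (F n k)\<^sup>2))"
        unfolding real_norm_def by linarith
    qed
  qed measurable
  have int_a: "integrable lborel (\<lambda>k. a k * (cmod (L2_fourier (\<phi> n) k))\<^sup>2)" for n
    using int_aF[of n] hat[of n] by (subst integrable_cong_AE) auto
  have kinetic: "(LINT k|lborel. a k * (cmod (L2_fourier (\<phi> n) k))\<^sup>2) \<le> \<bar>C\<bar> * inverse (real (Suc n))" for n
  proof -
    have "(LINT k|lborel. a k * (cmod (L2_fourier (\<phi> n) k))\<^sup>2) = (LINT k|lborel. a k * (F n k)\<^sup>2)"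
      using hat[of n] by (intro integral_cong_AE) auto
    also have "\<dots> \<le> (LINT k|lborel. C * (norm k ^ CARD('n) * (F n k)\<^sup>2))"
      by (rule integral_mono_AE[OF int_aF integrable_mult_right[OF F(7)] le])
    also have "\<dots> = C * (LINT k|lborel. norm k ^ CARD('n) * (F n k)\<^sup>2)" by simp
    also have "\<dots> \<le> \<bar>C\<bar> * (LINT k|lborel. norm k ^ CARD('n) * (F n k)\<^sup>2)"
      by (intro mult_right_mono integral_nonneg_AE) auto
    also have "\<dots> \<le> \<bar>C\<bar> * inverse (real (Suc n))"
      by (intro mult_left_mono F(8)) simp
    finally show ?thesis .
  qed
  have bound: "cmod (\<phi> n x) \<le> ?N" "cmod (\<phi> n x - of_real ?N) \<le> ?N * (\<rho> n * norm x)" for n x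
    using fourier_density_bounds[OF F(2,3,6,5), where x="- x"] by (simp_all add: \<phi>_def)
  have \<rho>0: "\<rho> \<longlonglongrightarrow> 0"
    unfolding \<rho>_def[abs_def] using tendsto_mult[OF tendsto_const LIMSEQ_inverse_real_of_nat, of \<delta>] by simp
  have pt: "(\<lambda>n. \<phi> n x) \<longlonglongrightarrow> of_real ?N" for x
  proof (rule LIM_zero_cancel, rule Lim_null_comparison)
    show "eventually (\<lambda>n. norm (\<phi> n x - of_real ?N) \<le> ?N * (\<rho> n * norm x)) sequentially"
      using bound(2) by simp
    have "(\<lambda>n. ?N * (\<rho> n * norm x)) \<longlonglongrightarrow> ?N * (0 * norm x)"
      by (intro tendsto_intros \<rho>0)
    then show "(\<lambda>n. ?N * (\<rho> n * norm x)) \<longlonglongrightarrow> 0" by simp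
  qed
  have Vle: "norm (V x * (cmod (\<phi> n x))\<^sup>2) \<le> \<bar>V x\<bar> * ?N\<^sup>2" for n x
    using power_mono[OF bound(1)[of n x], of 2] by (simp add: abs_mult mult_left_mono)
  have int_V: "integrable lborel (\<lambda>x. V x * (cmod (\<phi> n x))\<^sup>2)" for n
  proof (rule Bochner_Integration.integrable_bound)
    show "integrable lborel (\<lambda>x. \<bar>V x\<bar> * ?N\<^sup>2)" using V(1) by simp
    show "AE x in lborel. norm (V x * (cmod (\<phi> n x))\<^sup>2) \<le> norm (\<bar>V x\<bar> * ?N\<^sup>2)"
      using Vle by (auto intro!: AE_I2 intro: order_trans[OF _ abs_ge_self])
  qed measurable
  have dom: "\<phi> n \<in> form_domain a V" for n
    using \<phi>(1) int_a int_V by (simp add: form_domain_def)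
  have "(\<lambda>n. LINT x|lborel. V x * (cmod (\<phi> n x))\<^sup>2) \<longlonglongrightarrow> (LINT x|lborel. V x * (cmod (of_real ?N))\<^sup>2)"
  proof (rule integral_dominated_convergence[where w="\<lambda>x. \<bar>V x\<bar> * ?N\<^sup>2"])
    show "AE x in lborel. (\<lambda>n. V x * (cmod (\<phi> n x))\<^sup>2) \<longlonglongrightarrow> V x * (cmod (of_real ?N))\<^sup>2"
      by (intro AE_I2 tendsto_intros pt)
    show "AE x in lborel. norm (V x * (cmod (\<phi> n x))\<^sup>2) \<le> \<bar>V x\<bar> * ?N\<^sup>2" for n
      using Vle by (rule AE_I2)
  qed (use V(1) in simp_all)
  then have pot: "(\<lambda>n. LINT x|lborel. V x * (cmod (\<phi> n x))\<^sup>2) \<longlonglongrightarrow> (LINT x|lborel. V x) * ?N\<^sup>2"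
    by simp
  have "(\<lambda>n. \<bar>C\<bar> * inverse (real (Suc n)) - \<sigma> * (LINT x|lborel. V x * (cmod (\<phi> n x))\<^sup>2))
      \<longlonglongrightarrow> \<bar>C\<bar> * 0 - \<sigma> * ((LINT x|lborel. V x) * ?N\<^sup>2)"
    by (intro tendsto_diff tendsto_mult tendsto_const LIMSEQ_inverse_real_of_nat pot)
  moreover have "\<bar>C\<bar> * 0 - \<sigma> * ((LINT x|lborel. V x) * ?N\<^sup>2) < 0"
    using V(2) \<sigma> by (simp add: mult_pos_pos)
  ultimately have "eventually (\<lambda>n. \<bar>C\<bar> * inverse (real (Suc n)) - \<sigma> * (LINT x|lborel. V x * (cmod (\<phi> n x))\<^sup>2) < 0) sequentially"
    by (rule order_tendstoD(2))
  then obtain n where "\<bar>C\<bar> * inverse (real (Suc n)) - \<sigma> * (LINT x|lborel. V x * (cmod (\<phi> n x))\<^sup>2) < 0"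
    by (auto simp: eventually_sequentially)
  then have "energy a V \<sigma> (\<phi> n) < 0" unfolding energy_def using kinetic[of n] by linarith
  with dom show ?thesis by blast
qed

theorem theorem2p1:
  fixes a V :: "real^'n \<Rightarrow> real" and C \<sigma> :: real
  assumes "continuous_on UNIV a"
    and "\<And>k. k \<noteq> 0 \<Longrightarrow> a k > 0"
    and "eventually (\<lambda>k. a k \<le> C * norm k ^ CARD('n)) (at 0)"
    and "integrable lborel V"
    and "(LINT x|lborel. V x) > 0"
    and "\<sigma> > 0"
    and "well_defined_hamiltonian a V \<sigma>"
  shows "negative_spectrum (hamiltonian a V \<sigma>) \<noteq> {}"
proof
  assume empty: "negative_spectrum (hamiltonian a V \<sigma>) = {}"
  \<comment> \<open>At the origin, nonnegativity of the symbol follows by continuity.\<close>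
  have "(a \<longlongrightarrow> a 0) (at 0)"
    using assms(1) by (simp add: continuous_on_def)
  moreover have "eventually (\<lambda>k. 0 \<le> a k) (at 0)"
    using assms(2) by (auto simp: eventually_at intro!: exI[of _ 1] less_imp_le)
  ultimately have "0 \<le> a 0"
    by (intro tendsto_lowerbound[of a "a 0" "at 0"]) simp_all
  with assms(2) have a: "0 \<le> a k" for k by (cases "k = 0") (auto intro: less_imp_le)
  obtain \<phi> where "\<phi> \<in> form_domain a V" "energy a V \<sigma> \<phi> < 0"
    using negative_energy_exists[OF assms(1) a assms(3-6)] by blast
  moreover have "0 \<le> energy a V \<sigma> \<phi>" if "\<phi> \<in> form_domain a V"
    using borel_measurable_continuous_onI[OF assms(1)] borel_measurable_integrable[OF assms(4)] assms(6,7) a empty that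
    by (intro energy_nonneg_if_no_negative_spectrum) auto
  ultimately show False by fastforce
qed

end
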